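(* Let $(c_n)\in\ell^2_{\mathbb{R}}$. The Hamiltonian system $(\mathbb{CP}^\infty,\Omega^{\mathrm{FS}},H_{(c_n)})$ is completely integrable; that is, it possesses infinitely many Poisson-commuting conserved quantities. Moreover, let $t\mapsto(x_n)(t)$ be a gradient flow line of the restriction to $\mathcal{U}$ of the gradient flow of $H_{(c_n)}$ on $(\mathbb{CP}^\infty,\mathcal{G}^{\mathrm{FS}})$. Then the limit $p_{\max}:=\lim_{t\to\infty}\varPhi^{-1}\big((x_n)(t)\big)$ exists and solves the linear programming problem $$\max_{(p_n)\in\bar\Delta}\ \langle (c_n),(p_n)\rangle_{\ell^2}.$$
   Context: Sequences are indexed by $n\in\mathbb{N}=\{0,1,2,\dots\}$. $\ell^2_{\mathbb{R}}$ and $\ell^2_{\mathbb{C}}$ are the Hilbert spaces of real, respectively complex, square-summable sequences. $\ell^2_{\mathbb{C}}$ is regarded as a Kähler manifold with Riemannian metric $\mathrm{Re}\langle\cdot,\cdot\rangle_{\ell^2}$ and symplectic form $\omega=\frac{\mathrm{i}}{2}\sum_{j=0}^\infty dz_j\wedge d\bar z_j$. The circle $\mathbb{S}^1=\{e^{\mathrm{i}t}:t\in\mathbb{R}\}$ acts on the unit sphere $\mathbb{S}(\ell^2_{\mathbb{C}})$ by $e^{\mathrm{i}t}\cdot(z_n)=(e^{\mathrm{i}t}z_n)$, and $\mathbb{CP}^\infty:=\mathbb{S}(\ell^2_{\mathbb{C}})/\mathbb{S}^1$ with quotient map $\pi:z\mapsto[z]$ (so $[z]$ is always represented by a unit vector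 $z$). By Kähler reduction $\mathbb{CP}^\infty$ carries the Fubini–Study metric $\mathcal{G}^{\mathrm{FS}}$, for which $\pi$ is a Riemannian submersion from the round sphere, and the Fubini–Study symplectic form $\Omega^{\mathrm{FS}}$, for which $\pi^*\Omega^{\mathrm{FS}}$ is the restriction of $\omega$ to $\mathbb{S}(\ell^2_{\mathbb{C}})$. For $(c_n)\in\ell^2_{\mathbb{R}}$, $$H_{(c_n)}:\mathbb{CP}^\infty\to\mathbb{R},\qquad [z]\mapsto\sum_{n=0}^\infty c_n|z_n|^2 .$$ The Hamiltonian vector field $X_f$ of a smooth function $f$ is defined by $\Omega^{\mathrm{FS}}(X_f,\cdot)=df$, and $f,g$ Poisson commute if $\Omega^{\mathrm{FS}}(X_f,X_g)=0$. A conserved quantity of the system is a smooth function that Poisson commutes with $H_{(c_n)}$. The gradient flow of $H_{(c_n)}$ is the flow of its gradient vector field with respect to $\mathcal{G}^{\mathrm{FS}}$. $\mathcal{U}=\{(x_n)\in\ell^2_{\mathbb{R}}:\sum_{n=0}^\infty x_n^2=1,\ x_n>0\ \forall n\in\mathbb{N}\}\subset\mathbb{S}(\ell^2_{\mathbb{C}})$ is identified with its image under $\pi$ in $\mathbb{CP}^\infty$. $\Delta=\{(p_n)\in\ell^1_{\mathbb{R}}:\sum_{n=0}^\infty p_n=1,\ p_n>0\ \forall n\in\mathbb{N}\}$ is the $\ell^2$-probability simplex and $\varPhi:\Delta\to\mathcal{U}$, $(p_n)\mapsto(\sqrt{p_n})$, is the square-root map, with inverse $\varPhi^{-1}((x_n))=(x_n^2)$;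 $\Delta$ carries the differentiable structure for which $\varPhi$ is a diffeomorphism. $\bar\Delta=\{(p_n)\in\ell^1_{\mathbb{R}}:\sum_{n=0}^\infty p_n=1,\ p_n\ge0\ \forall n\in\mathbb{N}\}$ is the closure of $\Delta$, corresponding under $\varPhi$ to the closure of $\mathcal{U}$ in the unit sphere of $\ell^2_{\mathbb{R}}$; limits in $\bar\Delta$ are taken in the corresponding topology (the $\ell^1$ topology), and $\langle (c_n),(p_n)\rangle_{\ell^2}=\sum_{n=0}^\infty c_np_n$.
   Formalization: The claim about the limit is proved assuming that the linear programming problem has a maximiser; without this it is false, e.g. for c_n = -1/(n+1), where the maximum is not attained and the flow line has no limit. *)

theory Defs
  imports "HOL-Analysis.Analysis"
begin

section \<open>The complex Hilbert space of square-summable sequences\<close>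

typedef ell2 = "{z :: nat \<Rightarrow> complex. summable (\<lambda>n. (cmod (z n))\<^sup>2)}"
  morphisms coord Abs_ell2
  by (rule exI[of _ "\<lambda>_. 0"]) simp

setup_lifting type_definition_ell2

lemma summable_coord: "summable (\<lambda>n. (cmod (coord z n))\<^sup>2)"
  using coord[of z] by simp

lemma ell2_eqI: "(\<And>n. coord v n = coord w n) \<Longrightarrow> v = w"
  by (simp add: coord_inject[symmetric] fun_eq_iff)

lemma summable_sq_add:
  fixes v w :: "nat \<Rightarrow> complex"
  assumes "summable (\<lambda>n. (cmod (v n))\<^sup>2)" "summable (\<lambda>n. (cmod (w n))\<^sup>2)"
  shows "summable (\<lambda>n. (cmod (v n + w n))\<^sup>2)"
proof (rule summable_comparison_test')
  show "summable (\<lambda>n. 2 * (cmod (v n))\<^sup>2 + 2 * (cmod (w n))\<^sup>2)"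
    by (intro summable_add summable_mult assms)
  fix n :: nat
  have "(cmod (v n + w n))\<^sup>2 \<le> (cmod (v n) + cmod (w n))\<^sup>2"
    by (intro power_mono norm_triangle_ineq) simp
  also have "\<dots> \<le> 2 * (cmod (v n))\<^sup>2 + 2 * (cmod (w n))\<^sup>2"
    using zero_le_power2[of "cmod (v n) - cmod (w n)"] by (simp add: power2_eq_square algebra_simps)
  finally show "norm ((cmod (v n + w n))\<^sup>2) \<le> 2 * (cmod (v n))\<^sup>2 + 2 * (cmod (w n))\<^sup>2"
    by simp
qed

lemma summable_norm_mult_coord: "summable (\<lambda>n. cmod (coord v n) * cmod (coord w n))"
proof (rule summable_comparison_test')
  show "summable (\<lambda>n. (cmod (coord v n))\<^sup>2 + (cmod (coord w n))\<^sup>2)"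
    by (intro summable_add summable_coord)
  fix n :: nat
  have "norm (cmod (coord v n) * cmod (coord w n)) = cmod (coord v n) * cmod (coord w n)"
    "0 \<le> cmod (coord v n) * cmod (coord w n)" by simp_all
  with sum_squares_bound[of "cmod (coord v n)" "cmod (coord w n)"]
  show "norm (cmod (coord v n) * cmod (coord w n)) \<le> (cmod (coord v n))\<^sup>2 + (cmod (coord w n))\<^sup>2"
    by linarith
qed

lift_definition cscale :: "complex \<Rightarrow> ell2 \<Rightarrow> ell2" is "\<lambda>a z n. a * z n"
  by (simp add: norm_mult power_mult_distrib summable_mult)

instantiation ell2 :: real_inner
begin

lift_definition zero_ell2 :: ell2 is "\<lambda>_. 0" by simp
lift_definition plus_ell2 :: "ell2 \<Rightarrow> ell2 \<Rightarrow> ell2" is "\<lambda>v w n. v n + w n"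
  by (rule summable_sq_add)
lift_definition uminus_ell2 :: "ell2 \<Rightarrow> ell2" is "\<lambda>v n. - v n" by simp
definition minus_ell2 :: "ell2 \<Rightarrow> ell2 \<Rightarrow> ell2" where "v - w = v + - (w :: ell2)"
definition scaleR_ell2 :: "real \<Rightarrow> ell2 \<Rightarrow> ell2" where "scaleR_ell2 r v = cscale (complex_of_real r) v"

text \<open>The inner product of \<^typ>\<open>complex\<close> is the real part of the Hermitian one, so this is the real
  part of the Hermitian inner product of the sequences.\<close>

definition inner_ell2 :: "ell2 \<Rightarrow> ell2 \<Rightarrow> real" where
  "inner_ell2 v w = (\<Sum>n. inner (coord v n) (coord w n))"
definition norm_ell2 :: "ell2 \<Rightarrow> real" where "norm_ell2 v = sqrt (inner v v)"
definition dist_ell2 :: "ell2 \<Rightarrow> ell2 \<Rightarrow> real" where "dist_ell2 v w = norm (v - w)"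
definition sgn_ell2 :: "ell2 \<Rightarrow> ell2" where "sgn_ell2 v = inverse (norm v) *\<^sub>R v"
definition uniformity_ell2 :: "(ell2 \<times> ell2) filter" where
  "uniformity_ell2 = (INF e\<in>{0<..}. principal {(x, y). dist x y < e})"
definition open_ell2 :: "ell2 set \<Rightarrow> bool" where
  "open_ell2 U \<longleftrightarrow> (\<forall>x\<in>U. eventually (\<lambda>(x', y). x' = x \<longrightarrow> y \<in> U) uniformity)"

lemma coord_scaleR_aux: "coord (r *\<^sub>R v) n = r *\<^sub>R coord v n"
  by (simp add: scaleR_ell2_def cscale.rep_eq scaleR_conv_of_real)

lemma summable_inner_coord: "summable (\<lambda>n. inner (coord v n) (coord w n))"
  by (rule summable_comparison_test'[OF summable_norm_mult_coord[of v w]])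
    (simp add: Cauchy_Schwarz_ineq2)

instance
proof
  fix x y z :: ell2 and r s :: real
  show "x + y + z = x + (y + z)" by transfer (simp add: add.assoc)
  show "x + y = y + x" by transfer (simp add: add.commute)
  show "0 + x = x" by transfer simp
  show "- x + x = 0" by transfer simp
  show "x - y = x + - y" by (rule minus_ell2_def)
  show "r *\<^sub>R (x + y) = r *\<^sub>R x + r *\<^sub>R y"
    by (rule ell2_eqI) (simp add: coord_scaleR_aux plus_ell2.rep_eq scaleR_add_right)
  show "(r + s) *\<^sub>R x = r *\<^sub>R x + s *\<^sub>R x"
    by (rule ell2_eqI) (simp add: coord_scaleR_aux plus_ell2.rep_eq scaleR_add_left)
  show "r *\<^sub>R s *\<^sub>R x = (r * s) *\<^sub>R x"
    by (rule ell2_eqI) (simp add: coord_scaleR_aux)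
  show "1 *\<^sub>R x = x"
    by (rule ell2_eqI) (simp add: coord_scaleR_aux)
  show "dist x y = norm (x - y)" by (rule dist_ell2_def)
  show "sgn x = inverse (norm x) *\<^sub>R x" by (rule sgn_ell2_def)
  show "uniformity = (INF e\<in>{0<..}. principal {(x, y :: ell2). dist x y < e})"
    by (rule uniformity_ell2_def)
  show "open U \<longleftrightarrow> (\<forall>x\<in>U. eventually (\<lambda>(x', y). x' = x \<longrightarrow> y \<in> U) uniformity)"
    for U :: "ell2 set" by (rule open_ell2_def)
  show "inner x y = inner y x" by (simp add: inner_ell2_def inner_commute)
  show "inner (x + y) z = inner x z + inner y z"
    by (simp add: inner_ell2_def plus_ell2.rep_eq inner_add_left suminf_add summable_inner_coord)
  show "inner (r *\<^sub>R x) y = r * inner x y"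
    by (simp add: inner_ell2_def coord_scaleR_aux suminf_mult summable_inner_coord)
  show "0 \<le> inner x x"
    by (simp add: inner_ell2_def suminf_nonneg summable_inner_coord)
  show "inner x x = 0 \<longleftrightarrow> x = 0"
  proof
    assume "inner x x = 0"
    then have "\<forall>n. inner (coord x n) (coord x n) = 0"
      using suminf_eq_zero_iff[OF summable_inner_coord[of x x]] by (simp add: inner_ell2_def)
    then show "x = 0" by (intro ell2_eqI) (simp add: zero_ell2.rep_eq)
  qed (simp add: inner_ell2_def zero_ell2.rep_eq)
  show "norm x = sqrt (inner x x)" by (rule norm_ell2_def)
qed

end

lemma coord_zero [simp]: "coord 0 n = 0"
  by (simp add: zero_ell2.rep_eq)

lemma coord_add [simp]: "coord (v + w) n = coord v n + coord w n"
  by (simp add: plus_ell2.rep_eq)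

lemma coord_scaleR [simp]: "coord (r *\<^sub>R v) n = r *\<^sub>R coord v n"
  by (rule coord_scaleR_aux)

lemma coord_cscale [simp]: "coord (cscale a v) n = a * coord v n"
  by (simp add: cscale.rep_eq)

lemma coord_uminus [simp]: "coord (- v) n = - coord v n"
  by (simp add: uminus_ell2.rep_eq)

lemma coord_diff [simp]: "coord (v - w) n = coord v n - coord w n"
  using coord_add[of v "- w" n] by simp

lemma cscale_1 [simp]: "cscale 1 v = v"
  by (rule ell2_eqI) simp

lemma cscale_cscale [simp]: "cscale a (cscale b v) = cscale (a * b) v"
  by (rule ell2_eqI) simp

lemma cscale_add: "cscale a (v + w) = cscale a v + cscale a w"
  by (rule ell2_eqI) (simp add: algebra_simps)

lemma cscale_scaleR: "cscale a (r *\<^sub>R v) = r *\<^sub>R cscale a v"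
  by (rule ell2_eqI) simp

lemma cscale_add_left: "cscale (a + b) v = cscale a v + cscale b v"
  by (rule ell2_eqI) (simp add: algebra_simps)

lemma scaleR_cscale: "r *\<^sub>R v = cscale (of_real r) v"
  by (rule ell2_eqI) (simp add: scaleR_conv_of_real)

lemma inner_unit_mult:
  assumes "cmod u = 1"
  shows "inner (u * a) (u * b) = inner a b"
proof -
  have eq: "inner p q = Re (p * cnj q)" for p q :: complex by (simp add: inner_complex_def)
  have "u * a * cnj (u * b) = (u * cnj u) * (a * cnj b)" by (simp add: mult_ac)
  also have "u * cnj u = 1" using assms complex_norm_square[of u] by simp
  finally have "u * a * cnj (u * b) = a * cnj b" by simp
  then show ?thesis unfolding eq by (rule arg_cong)
qed

lemma inner_cscale_unit:
  "cmod u = 1 \<Longrightarrow> inner (cscale u v) (cscale u w) = inner v w"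
  by (simp add: inner_ell2_def inner_unit_mult)

lemma norm_cscale_unit: "cmod u = 1 \<Longrightarrow> norm (cscale u v) = norm v"
  by (simp add: norm_eq_sqrt_inner inner_cscale_unit)

lemma inner_cscale_i: "inner (cscale \<i> v) v = 0"
  by (simp add: inner_ell2_def inner_complex_def)

lemma inner_cscale_i_swap: "inner (cscale \<i> v) w = - inner v (cscale \<i> w)"
proof -
  have "inner (cscale \<i> v) w = (\<Sum>n. - inner (coord v n) (coord (cscale \<i> w) n))"
    unfolding inner_ell2_def by (intro suminf_cong) (simp add: inner_complex_def)
  also have "\<dots> = - inner v (cscale \<i> w)"
    unfolding inner_ell2_def by (rule suminf_minus) (rule summable_inner_coord)
  finally show ?thesis .
qed

text \<open>The form \<open>(\<i>/2) \<Sum>\<^sub>j dz\<^sub>j \<and> d\<bar>z\<^sub>j\<close>, with \<open>dz\<^sub>j\<close> and \<open>d\<bar>z\<^sub>j\<close> evaluated at the vectors \<open>v\<close>, \<open>w\<close>; every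
  summand is a real number.\<close>

definition omega :: "ell2 \<Rightarrow> ell2 \<Rightarrow> real" where
  "omega v w = (\<Sum>j. Re (\<i> / 2 * (coord v j * cnj (coord w j) - coord w j * cnj (coord v j))))"

lemma omega_eq: "omega v w = inner (cscale \<i> v) w"
  unfolding omega_def inner_ell2_def
  by (intro suminf_cong) (simp add: inner_complex_def field_simps)

section \<open>Infinite-dimensional complex projective space and its tangent bundle\<close>

abbreviation unit_sphere :: "ell2 set" where
  "unit_sphere \<equiv> sphere 0 1"

definition phase_rel :: "ell2 \<Rightarrow> ell2 \<Rightarrow> bool" where
  "phase_rel z w \<longleftrightarrow> z \<in> unit_sphere \<and> w \<in> unit_sphere \<and> (\<exists>t. w = cscale (cis t) z)"

lemma ex_unit: "\<exists>z. z \<in> unit_sphere"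
proof -
  have s: "summable (\<lambda>n. (cmod (if n = 0 then 1 else 0))\<^sup>2)"
    by (rule summable_finite[of "{0}"]) auto
  define e where "e = Abs_ell2 (\<lambda>n. if n = 0 then 1 else 0)"
  have "coord e = (\<lambda>n. if n = 0 then 1 else 0)"
    unfolding e_def using s by (intro Abs_ell2_inverse) simp
  then have "e \<noteq> 0" by (metis coord_zero zero_neq_one)
  then have "norm (sgn e) = 1" by (simp add: norm_sgn)
  then show ?thesis by (intro exI[of _ "sgn e"]) simp
qed

text \<open>Only \<open>proj z\<close> with \<open>z\<close> on the unit sphere is meaningful.\<close>

quotient_type cp = ell2 / partial: phase_rel
  morphisms rep_cp proj
proof (rule part_equivpI)
  obtain z where "z \<in> unit_sphere" using ex_unit by blast
  then have "phase_rel z z" unfolding phase_rel_def by (auto intro: exI[of _ 0])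
  then show "\<exists>z. phase_rel z z" ..
  show "symp phase_rel"
  proof (rule sympI)
    fix z w assume "phase_rel z w"
    then obtain t where t: "z \<in> unit_sphere" "w \<in> unit_sphere" "w = cscale (cis t) z"
      by (auto simp: phase_rel_def)
    then have "z = cscale (cis (- t)) w" by (simp add: cis_mult)
    with t(1,2) show "phase_rel w z" unfolding phase_rel_def by blast
  qed
  show "transp phase_rel"
    by (rule transpI) (auto simp: phase_rel_def cis_mult)
qed

lemma proj_eq_iff:
  assumes "z \<in> unit_sphere" "w \<in> unit_sphere"
  shows "proj z = proj w \<longleftrightarrow> (\<exists>t. w = cscale (cis t) z)"
proof -
  have r: "phase_rel x x" if "x \<in> unit_sphere" for x
    using that unfolding phase_rel_def by (auto intro: exI[of _ 0])
  show ?thesis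
    using Quotient_rel[OF Quotient_cp, of z w] r assms by (auto simp: phase_rel_def)
qed

lemma proj_surj:
  obtains z where "z \<in> unit_sphere" "p = proj z"
  using Quotient_rep_reflp[OF Quotient_cp, of p] Quotient_abs_rep[OF Quotient_cp, of p]
  by (metis phase_rel_def)

definition tangent :: "ell2 \<Rightarrow> ell2 \<Rightarrow> bool" where
  "tangent z v \<longleftrightarrow> z \<in> unit_sphere \<and> inner z v = 0"

text \<open>A tangent vector of the quotient is a pair \<open>(z, v)\<close> with \<open>v\<close> tangent to the sphere at \<open>z\<close>, modulo
  the action of the circle on the tangent bundle of the sphere and modulo the tangent space
  \<open>\<real>\<i>z\<close> of the orbit.\<close>

definition tangent_rel :: "ell2 \<times> ell2 \<Rightarrow> ell2 \<times> ell2 \<Rightarrow> bool" where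
  "tangent_rel = (\<lambda>(z, v) (w, u). tangent z v \<and> tangent w u \<and>
     (\<exists>t a. w = cscale (cis t) z \<and> u = cscale (cis t) (v + a *\<^sub>R cscale \<i> z)))"

quotient_type tcp = "ell2 \<times> ell2" / partial: tangent_rel
  morphisms rep_tcp abs_tcp
proof (rule part_equivpI)
  obtain z where "z \<in> unit_sphere" using ex_unit by blast
  then have "tangent_rel (z, 0) (z, 0)"
    unfolding tangent_rel_def tangent_def by (auto intro!: exI[of _ 0])
  then show "\<exists>x. tangent_rel x x" ..
  show "symp tangent_rel"
  proof (rule sympI)
    fix x y assume "tangent_rel x y"
    moreover obtain z v w u where xy: "x = (z, v)" "y = (w, u)" by (metis surj_pair)
    ultimately obtain t a where t: "x = (z, v)" "y = (w, u)" "tangent z v" "tangent w u"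
      "w = cscale (cis t) z" "u = cscale (cis t) (v + a *\<^sub>R cscale \<i> z)"
      unfolding tangent_rel_def by blast
    have z: "z = cscale (cis (- t)) w" using t by (simp add: cis_mult)
    have "cscale (cis (- t)) u = v + a *\<^sub>R cscale \<i> z"
      using t(6) by (simp add: cis_mult)
    moreover have "cscale (cis (- t)) ((- a) *\<^sub>R cscale \<i> w) = - (a *\<^sub>R cscale \<i> z)"
    proof (rule ell2_eqI)
      fix n
      have "cis (- t) * (cis t * coord z n) = coord z n"
        by (simp add: cis_mult flip: mult.assoc)
      then show "coord (cscale (cis (- t)) ((- a) *\<^sub>R cscale \<i> w)) n = coord (- (a *\<^sub>R cscale \<i> z)) n"
        unfolding t(5) by (simp add: mult.left_commute[of _ \<i>])
    qed
    ultimately have "cscale (cis (- t)) (u + (- a) *\<^sub>R cscale \<i> w) = v"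
      unfolding cscale_add by simp
    note this[symmetric]
    with z have "\<exists>t a. z = cscale (cis t) w \<and> v = cscale (cis t) (u + a *\<^sub>R cscale \<i> w)"
      by (intro exI conjI)
    with t(3,4) show "tangent_rel y x" unfolding t(1,2) tangent_rel_def prod.case by (intro conjI)
  qed
  show "transp tangent_rel"
  proof (rule transpI)
    fix x y q assume "tangent_rel x y" "tangent_rel y q"
    moreover obtain z v w u r l where xy: "x = (z, v)" "y = (w, u)" "q = (r, l)"
      by (metis surj_pair)
    ultimately obtain t a s b where t: "x = (z, v)" "y = (w, u)" "q = (r, l)"
      "tangent z v" "tangent r l"
      "w = cscale (cis t) z" "u = cscale (cis t) (v + a *\<^sub>R cscale \<i> z)"
      "r = cscale (cis s) w" "l = cscale (cis s) (u + b *\<^sub>R cscale \<i> w)"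
      unfolding tangent_rel_def by blast
    have "r = cscale (cis (s + t)) z" using t by (simp add: cis_mult)
    moreover have "l = cscale (cis (s + t)) (v + (a + b) *\<^sub>R cscale \<i> z)"
    proof (rule ell2_eqI)
      fix n
      have "cis (s + t) = cis s * cis t" by (simp add: cis_mult)
      then show "coord l n = coord (cscale (cis (s + t)) (v + (a + b) *\<^sub>R cscale \<i> z)) n"
        unfolding t(9,7,6) by (simp add: scaleR_conv_of_real ring_distribs mult_ac)
    qed
    ultimately have "\<exists>t a. r = cscale (cis t) z \<and> l = cscale (cis t) (v + a *\<^sub>R cscale \<i> z)"
      by (intro exI conjI)
    with t(4,5) show "tangent_rel x q" unfolding t(1,3) tangent_rel_def prod.case by (intro conjI)
  qed
qed

text \<open>\<open>dproj z\<close> is the differential of \<open>proj\<close> at the unit vector \<open>z\<close>, defined on the tangent space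
  of the sphere at \<open>z\<close>.\<close>

definition dproj :: "ell2 \<Rightarrow> ell2 \<Rightarrow> tcp" where
  "dproj z v = abs_tcp (z, v)"

lift_definition base :: "tcp \<Rightarrow> cp" is fst
  by (auto simp: tangent_rel_def phase_rel_def tangent_def)

lemma tangent_rel_refl: "tangent z v \<Longrightarrow> tangent_rel (z, v) (z, v)"
  unfolding tangent_rel_def by (auto intro!: exI[of _ 0])

lemma dproj_eq_iff:
  assumes "tangent z v" "tangent w u"
  shows "dproj z v = dproj w u \<longleftrightarrow>
    (\<exists>t a. w = cscale (cis t) z \<and> u = cscale (cis t) (v + a *\<^sub>R cscale \<i> z))"
  using Quotient_rel[OF Quotient_tcp, of "(z, v)" "(w, u)"] assms tangent_rel_refl
  by (auto simp: tangent_rel_def dproj_def)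

lemma dproj_surj:
  obtains z v where "tangent z v" "\<xi> = dproj z v"
proof -
  have "tangent_rel (rep_tcp \<xi>) (rep_tcp \<xi>)" "abs_tcp (rep_tcp \<xi>) = \<xi>"
    using Quotient_rep_reflp[OF Quotient_tcp, of \<xi>] Quotient_abs_rep[OF Quotient_tcp, of \<xi>] by auto
  then show ?thesis
    using that[of "fst (rep_tcp \<xi>)" "snd (rep_tcp \<xi>)"]
    by (auto simp: dproj_def tangent_rel_def split: prod.splits)
qed

lemma base_dproj: "tangent z v \<Longrightarrow> base (dproj z v) = proj z"
  using base.abs_eq[of "(z, v)"] by (simp add: dproj_def tangent_rel_refl)

lemma dproj_surj_at:
  assumes "z \<in> unit_sphere" "base \<xi> = proj z"
  obtains v where "tangent z v" "\<xi> = dproj z v"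
proof -
  obtain w u where w: "tangent w u" "\<xi> = dproj w u" by (rule dproj_surj)
  then have "proj w = proj z" using assms by (simp add: base_dproj)
  then obtain t where t: "z = cscale (cis t) w"
    using proj_eq_iff assms w by (auto simp: tangent_def)
  define v where "v = cscale (cis t) u"
  have "tangent z v"
    using w(1) assms by (simp add: tangent_def t v_def inner_cscale_unit)
  moreover have "\<exists>t' a. z = cscale (cis t') w \<and> v = cscale (cis t') (u + a *\<^sub>R cscale \<i> w)"
    using t v_def by (intro exI[of _ t] exI[of _ 0]) simp
  ultimately have "\<xi> = dproj z v" "tangent z v"
    using dproj_eq_iff[OF w(1)] w(2) by blast+
  then show ?thesis by (intro that)
qed

section \<open>The Fubini-Study symplectic form and metric\<close>

text \<open>The 2-form whose pull-back under \<open>proj\<close> is the restriction of \<^const>\<open>omega\<close> to the sphere; its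
  arguments are tangent vectors with the same base point.\<close>

definition Omega_FS :: "tcp \<Rightarrow> tcp \<Rightarrow> real" where
  "Omega_FS \<xi> \<eta> = (THE r. \<exists>z v w. tangent z v \<and> tangent z w \<and>
     \<xi> = dproj z v \<and> \<eta> = dproj z w \<and> r = omega v w)"

definition horizontal :: "ell2 \<Rightarrow> ell2 \<Rightarrow> bool" where
  "horizontal z v \<longleftrightarrow> tangent z v \<and> inner (cscale \<i> z) v = 0"

text \<open>The metric for which \<^const>\<open>dproj\<close> is isometric on the orthogonal complement of its kernel
  \<open>\<real>\<i>z\<close>.\<close>

definition metric_FS :: "tcp \<Rightarrow> tcp \<Rightarrow> real" where
  "metric_FS \<xi> \<eta> = (THE r. \<exists>z v w. horizontal z v \<and> horizontal z w \<and>
     \<xi> = dproj z v \<and> \<eta> = dproj z w \<and> r = inner v w)"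

lemma Omega_FS_dproj:
  assumes "tangent z v" "tangent z w"
  shows "Omega_FS (dproj z v) (dproj z w) = omega v w"
  unfolding Omega_FS_def
proof (rule the_equality)
  show "\<exists>z' v' w'. tangent z' v' \<and> tangent z' w' \<and> dproj z v = dproj z' v' \<and>
    dproj z w = dproj z' w' \<and> omega v w = omega v' w'"
    using assms by blast
  fix r
  assume "\<exists>z' v' w'. tangent z' v' \<and> tangent z' w' \<and> dproj z v = dproj z' v' \<and>
    dproj z w = dproj z' w' \<and> r = omega v' w'"
  then obtain z' v' w' where *: "tangent z' v'" "tangent z' w'" "dproj z v = dproj z' v'"
    "dproj z w = dproj z' w'" "r = omega v' w'" by blast
  obtain t a where a: "z' = cscale (cis t) z" "v' = cscale (cis t) (v + a *\<^sub>R cscale \<i> z)"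
    using * assms dproj_eq_iff by metis
  obtain s b where b: "z' = cscale (cis s) z" "w' = cscale (cis s) (w + b *\<^sub>R cscale \<i> z)"
    using * assms dproj_eq_iff by metis
  have "z \<noteq> 0" using assms by (auto simp: tangent_def)
  then obtain n where n: "coord z n \<noteq> 0" using ell2_eqI[of z 0] by auto
  have "cis t * coord z n = cis s * coord z n" using a(1) b(1) by (metis coord_cscale)
  with n have "cis s = cis t" by simp
  with b have b': "w' = cscale (cis t) (w + b *\<^sub>R cscale \<i> z)" by simp
  have iz: "cscale \<i> (a *\<^sub>R cscale \<i> z) = - (a *\<^sub>R z)"
    by (rule ell2_eqI) simp
  have "r = inner (cscale \<i> (v + a *\<^sub>R cscale \<i> z)) (w + b *\<^sub>R cscale \<i> z)"
  proof -
    have "cscale \<i> v' = cscale (cis t) (cscale \<i> (v + a *\<^sub>R cscale \<i> z))"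
      unfolding a by (simp add: mult.commute)
    then show ?thesis unfolding *(5) omega_eq by (simp only: b' inner_cscale_unit norm_cis)
  qed
  also have "\<dots> = inner (cscale \<i> v) w + b * inner (cscale \<i> v) (cscale \<i> z) - a * inner z w
     - a * b * inner z (cscale \<i> z)"
    by (simp add: cscale_add iz algebra_simps)
  also have "inner (cscale \<i> v) (cscale \<i> z) = 0"
    using assms by (simp add: inner_cscale_unit tangent_def inner_commute)
  also have "inner z (cscale \<i> z) = 0"
    using inner_cscale_i[of z] by (simp add: inner_commute)
  finally show "r = omega v w" using assms by (simp add: omega_eq tangent_def)
qed

lemma metric_FS_dproj:
  assumes "horizontal z v" "horizontal z w"
  shows "metric_FS (dproj z v) (dproj z w) = inner v w"
  unfolding metric_FS_def
proof (rule the_equality)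
  show "\<exists>z' v' w'. horizontal z' v' \<and> horizontal z' w' \<and> dproj z v = dproj z' v' \<and>
    dproj z w = dproj z' w' \<and> inner v w = inner v' w'"
    using assms by blast
  fix r
  assume "\<exists>z' v' w'. horizontal z' v' \<and> horizontal z' w' \<and> dproj z v = dproj z' v' \<and>
    dproj z w = dproj z' w' \<and> r = inner v' w'"
  then obtain z' v' w' where *: "horizontal z' v'" "horizontal z' w'" "dproj z v = dproj z' v'"
    "dproj z w = dproj z' w'" "r = inner v' w'" by blast
  have z1: "inner z z = 1" using assms by (simp add: horizontal_def tangent_def norm_eq_1)
  have key: "v1 = cscale (cis t) v0"
    if "horizontal z v0" "horizontal z' v1" "z' = cscale (cis t) z"
      "v1 = cscale (cis t) (v0 + a *\<^sub>R cscale \<i> z)" for v0 v1 t a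
  proof -
    have "cscale \<i> z' = cscale (cis t) (cscale \<i> z)" using that by (simp add: mult.commute)
    then have "inner (cscale \<i> z') v1 = inner (cscale \<i> z) (v0 + a *\<^sub>R cscale \<i> z)"
      by (simp only: that(4) inner_cscale_unit norm_cis)
    then have "0 = inner (cscale \<i> z) (v0 + a *\<^sub>R cscale \<i> z)"
      using that(2) by (simp add: horizontal_def)
    also have "\<dots> = a"
      using that z1 by (simp add: horizontal_def inner_add_right inner_cscale_unit)
    finally show ?thesis using that(4) by simp
  qed
  obtain t a where a: "z' = cscale (cis t) z" "v' = cscale (cis t) (v + a *\<^sub>R cscale \<i> z)"
    using * assms dproj_eq_iff unfolding horizontal_def by metis
  obtain s b where b: "z' = cscale (cis s) z" "w' = cscale (cis s) (w + b *\<^sub>R cscale \<i> z)"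
    using * assms dproj_eq_iff unfolding horizontal_def by metis
  have "z \<noteq> 0" using z1 by auto
  then obtain n where n: "coord z n \<noteq> 0" using ell2_eqI[of z 0] by auto
  have "cis t * coord z n = cis s * coord z n" using a(1) b(1) by (metis coord_cscale)
  with n have "cis s = cis t" by simp
  then have "v' = cscale (cis t) v" "w' = cscale (cis t) w"
    using key[OF assms(1) *(1) a] key[OF assms(2) *(2) b] by simp_all
  then show "r = inner v w" using *(5) by (simp add: inner_cscale_unit)
qed

section \<open>Smooth functions and their differentials\<close>

definition bounded_multilinear :: "nat \<Rightarrow> ('a::real_normed_vector list \<Rightarrow> 'b::real_normed_vector) \<Rightarrow> bool"
  where "bounded_multilinear k M \<longleftrightarrow>
    (\<forall>us vs. length us + length vs + 1 = k \<longrightarrow> linear (\<lambda>h. M (us @ h # vs))) \<and>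
    (\<exists>C. \<forall>vs. length vs = k \<longrightarrow> norm (M vs) \<le> C * prod_list (map norm vs))"

text \<open>Infinite Frechet differentiability on an open set \<open>W\<close>: on lists of length \<open>k\<close>, \<open>D x\<close> is the
  \<open>k\<close>-th derivative at \<open>x\<close>, and \<open>h \<mapsto> D x (h # _)\<close> is the Frechet derivative of the \<open>k\<close>-th
  derivative with respect to the operator norm on bounded \<open>k\<close>-linear maps.\<close>

definition smooth_on :: "'a::real_normed_vector set \<Rightarrow> ('a \<Rightarrow> 'b::real_normed_vector) \<Rightarrow> bool" where
  "smooth_on W f \<longleftrightarrow> (\<exists>D. \<forall>x\<in>W. D x [] = f x \<and> (\<forall>k. bounded_multilinear k (D x) \<and>
     (\<forall>e>0. \<exists>d>0. \<forall>h vs. norm h < d \<and> length vs = k \<longrightarrow>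
        norm (D (x + h) vs - D x vs - D x (h # vs)) \<le> e * norm h * prod_list (map norm vs))))"

text \<open>As \<open>proj\<close> is a surjective submersion, a function on the quotient is smooth iff its pull-back to the
  sphere is, i.e. iff the latter extends locally to a smooth function on the ambient space.\<close>

definition smooth_cp :: "(cp \<Rightarrow> real) \<Rightarrow> bool" where
  "smooth_cp f \<longleftrightarrow> (\<forall>z\<in>unit_sphere. \<exists>W G. open W \<and> z \<in> W \<and> smooth_on W G \<and>
     (\<forall>w \<in> W \<inter> unit_sphere. G w = f (proj w)))"

text \<open>The derivative of \<open>f\<close> along the curve \<open>s \<mapsto> proj (sgn (z + s v))\<close>, whose velocity at \<open>s = 0\<close> is
  \<open>dproj z v\<close>.\<close>

definition differential :: "(cp \<Rightarrow> real) \<Rightarrow> tcp \<Rightarrow> real" where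
  "differential f \<xi> = (THE r. \<exists>z v. tangent z v \<and> \<xi> = dproj z v \<and>
     ((\<lambda>s. f (proj (sgn (z + s *\<^sub>R v)))) has_real_derivative r) (at 0))"

section \<open>Hamiltonian systems\<close>

definition vector_field :: "(cp \<Rightarrow> tcp) \<Rightarrow> bool" where
  "vector_field X \<longleftrightarrow> (\<forall>p. base (X p) = p)"

definition hamiltonian_vector_field :: "(cp \<Rightarrow> real) \<Rightarrow> (cp \<Rightarrow> tcp) \<Rightarrow> bool" where
  "hamiltonian_vector_field f X \<longleftrightarrow>
     vector_field X \<and> (\<forall>\<xi>. Omega_FS (X (base \<xi>)) \<xi> = differential f \<xi>)"

definition poisson_commute :: "(cp \<Rightarrow> real) \<Rightarrow> (cp \<Rightarrow> real) \<Rightarrow> bool" where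
  "poisson_commute f g \<longleftrightarrow> (\<exists>X Y. hamiltonian_vector_field f X \<and> hamiltonian_vector_field g Y \<and>
     (\<forall>p. Omega_FS (X p) (Y p) = 0))"

definition conserved_quantity :: "(cp \<Rightarrow> real) \<Rightarrow> (cp \<Rightarrow> real) \<Rightarrow> bool" where
  "conserved_quantity h f \<longleftrightarrow> smooth_cp f \<and> poisson_commute f h"

definition differentials_independent_at :: "(cp \<Rightarrow> real) set \<Rightarrow> cp \<Rightarrow> bool" where
  "differentials_independent_at F p \<longleftrightarrow>
     (\<forall>a. (\<forall>\<xi>. base \<xi> = p \<longrightarrow> (\<Sum>f\<in>F. a f * differential f \<xi>) = 0) \<longrightarrow> (\<forall>f\<in>F. a f = 0))"

text \<open>Density is expressed on the sphere; \<open>proj\<close> is continuous and open.\<close>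

definition functionally_independent :: "(cp \<Rightarrow> real) set \<Rightarrow> bool" where
  "functionally_independent F \<longleftrightarrow> (\<forall>F0. F0 \<subseteq> F \<and> finite F0 \<longrightarrow>
     unit_sphere \<subseteq> closure {z \<in> unit_sphere. differentials_independent_at F0 (proj z)})"

text \<open>Without functional independence, the constant functions would be admitted as an infinite
  family of conserved quantities of every system.\<close>

definition completely_integrable :: "(cp \<Rightarrow> real) \<Rightarrow> bool" where
  "completely_integrable h \<longleftrightarrow> (\<exists>F. infinite F \<and> (\<forall>f\<in>F. conserved_quantity h f) \<and>
     (\<forall>f\<in>F. \<forall>g\<in>F. poisson_commute f g) \<and> functionally_independent F)"

lift_definition H :: "(nat \<Rightarrow> real) \<Rightarrow> cp \<Rightarrow> real" is
  "\<lambda>c z. \<Sum>n. c n * (cmod (coord z n))\<^sup>2"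
  by (auto simp: phase_rel_def norm_mult)

lemma H_proj:
  assumes "z \<in> unit_sphere"
  shows "H c (proj z) = (\<Sum>n. c n * (cmod (coord z n))\<^sup>2)"
  by (rule H.abs_eq) (use assms in \<open>auto simp: phase_rel_def intro: exI[of _ 0]\<close>)

section \<open>Gradient flows\<close>

definition gradient_field :: "(cp \<Rightarrow> real) \<Rightarrow> (cp \<Rightarrow> tcp) \<Rightarrow> bool" where
  "gradient_field f X \<longleftrightarrow>
     vector_field X \<and> (\<forall>\<xi>. metric_FS (X (base \<xi>)) \<xi> = differential f \<xi>)"

text \<open>A curve in the quotient has velocity \<open>\<xi>\<close> at \<open>t\<close> if it has a local lift to the sphere that is
  differentiable at \<open>t\<close> with derivative representing \<open>\<xi>\<close>.\<close>

definition has_velocity :: "(real \<Rightarrow> cp) \<Rightarrow> tcp \<Rightarrow> real \<Rightarrow> real set \<Rightarrow> bool" where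
  "has_velocity \<gamma> \<xi> t T \<longleftrightarrow> (\<exists>z v.
     (\<forall>\<^sub>F s in at t within T. z s \<in> unit_sphere \<and> proj (z s) = \<gamma> s) \<and>
     z t \<in> unit_sphere \<and> proj (z t) = \<gamma> t \<and>
     (z has_vector_derivative v) (at t within T) \<and> tangent (z t) v \<and> \<xi> = dproj (z t) v)"

definition gradient_flow_line :: "(cp \<Rightarrow> real) \<Rightarrow> real set \<Rightarrow> (real \<Rightarrow> cp) \<Rightarrow> bool" where
  "gradient_flow_line f T \<gamma> \<longleftrightarrow>
     (\<exists>X. gradient_field f X \<and> (\<forall>t\<in>T. has_velocity \<gamma> (X (\<gamma> t)) t T))"

section \<open>The simplex and the square-root map\<close>

definition U :: "ell2 set" where
  "U = {x \<in> unit_sphere. \<forall>n. Im (coord x n) = 0 \<and> Re (coord x n) > 0}"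

definition Delta :: "(nat \<Rightarrow> real) set" where
  "Delta = {p. p sums 1 \<and> (\<forall>n. p n > 0)}"

definition Delta_bar :: "(nat \<Rightarrow> real) set" where
  "Delta_bar = {p. p sums 1 \<and> (\<forall>n. p n \<ge> 0)}"

definition Phi :: "(nat \<Rightarrow> real) \<Rightarrow> ell2" where
  "Phi p = Abs_ell2 (\<lambda>n. complex_of_real (sqrt (p n)))"

lemma coord_Phi:
  assumes "p \<in> Delta"
  shows "coord (Phi p) n = complex_of_real (sqrt (p n))"
proof -
  have "(\<lambda>n. (cmod (complex_of_real (sqrt (p n))))\<^sup>2) = p"
    using assms by (auto simp: Delta_def less_imp_le)
  moreover have "summable p" using assms by (auto simp: Delta_def sums_iff)
  ultimately show ?thesis unfolding Phi_def by (simp add: Abs_ell2_inverse)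
qed

lemma norm_sq_ell2: "(\<lambda>n. (cmod (coord z n))\<^sup>2) sums (norm z)\<^sup>2"
  using summable_sums[OF summable_coord[of z]]
  by (simp only: power2_norm_eq_inner inner_ell2_def)

lemma Phi_mem_U: "p \<in> Delta \<Longrightarrow> Phi p \<in> U"
proof -
  assume p: "p \<in> Delta"
  have "(\<lambda>n. (cmod (coord (Phi p) n))\<^sup>2) = p"
    using p coord_Phi[OF p] by (auto simp: Delta_def less_imp_le)
  then have "p sums (norm (Phi p))\<^sup>2" using norm_sq_ell2[of "Phi p"] by simp
  moreover have "p sums 1" using p by (simp add: Delta_def)
  ultimately have "(norm (Phi p))\<^sup>2 = 1" using sums_unique2 by blast
  then have "norm (Phi p) = 1" using norm_ge_zero[of "Phi p"] by (auto simp: power2_eq_1_iff)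
  then show ?thesis using p coord_Phi[OF p] by (simp add: U_def Delta_def)
qed

lemma sq_mem_Delta:
  assumes "x \<in> U"
  shows "(\<lambda>n. (Re (coord x n))\<^sup>2) \<in> Delta" "Phi (\<lambda>n. (Re (coord x n))\<^sup>2) = x"
proof -
  have eq: "(\<lambda>n. (cmod (coord x n))\<^sup>2) = (\<lambda>n. (Re (coord x n))\<^sup>2)"
    using assms by (auto simp: U_def cmod_power2)
  have pos: "Re (coord x n) > 0" "Im (coord x n) = 0" for n using assms by (auto simp: U_def)
  show D: "(\<lambda>n. (Re (coord x n))\<^sup>2) \<in> Delta"
  proof -
    have "(Re (coord x n))\<^sup>2 > 0" for n using pos(1)[of n] by (intro zero_less_power)
    then show ?thesis using norm_sq_ell2[of x] assms unfolding eq by (simp add: Delta_def U_def)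
  qed
  show "Phi (\<lambda>n. (Re (coord x n))\<^sup>2) = x"
    using pos by (intro ell2_eqI) (simp add: coord_Phi[OF D] complex_eq_iff less_imp_le)
qed

lemma bij_betw_Phi: "bij_betw Phi Delta U"
  unfolding bij_betw_def
proof
  show "inj_on Phi Delta"
  proof (rule inj_onI)
    fix p q assume pq: "p \<in> Delta" "q \<in> Delta" "Phi p = Phi q"
    then have "complex_of_real (sqrt (p n)) = complex_of_real (sqrt (q n))" for n
      using coord_Phi[OF pq(1), of n] coord_Phi[OF pq(2), of n] pq(3) by simp
    then show "p = q" by auto
  qed
  show "Phi ` Delta = U"
  proof
    show "Phi ` Delta \<subseteq> U" using Phi_mem_U by blast
    show "U \<subseteq> Phi ` Delta" using sq_mem_Delta by (intro subsetI) (rule image_eqI, rule sym)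
  qed
qed

lemma inv_into_Phi: "x \<in> U \<Longrightarrow> inv_into Delta Phi x = (\<lambda>n. (Re (coord x n))\<^sup>2)"
  using bij_betw_Phi sq_mem_Delta[of x] by (metis bij_betw_def inv_into_f_f)

text \<open>Convergence in \<open>\<ell>\<^sup>1\<close>; used only for absolutely summable sequences.\<close>

definition l1_tendsto :: "('a \<Rightarrow> nat \<Rightarrow> real) \<Rightarrow> (nat \<Rightarrow> real) \<Rightarrow> 'a filter \<Rightarrow> bool" where
  "l1_tendsto p q F \<longleftrightarrow> ((\<lambda>t. \<Sum>n. \<bar>p t n - q n\<bar>) \<longlongrightarrow> 0) F"

definition pairing :: "(nat \<Rightarrow> real) \<Rightarrow> (nat \<Rightarrow> real) \<Rightarrow> real" where
  "pairing c p = (\<Sum>n. c n * p n)"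

text \<open>The maximum need not be attained: if \<open>c\<close> is square-summable and \<open>c n < 0\<close> for all \<open>n\<close>, then the
  supremum of \<open>pairing c\<close> over \<^const>\<open>Delta_bar\<close> is 0, but every value is negative.\<close>

definition solves_lp :: "(nat \<Rightarrow> real) \<Rightarrow> (nat \<Rightarrow> real) \<Rightarrow> bool" where
  "solves_lp c p \<longleftrightarrow> p \<in> Delta_bar \<and> (\<forall>q \<in> Delta_bar. pairing c q \<le> pairing c p)"

end

theory Submission
  imports Defs
begin

text \<open>
  For bounded \<open>d\<close>, the function \<open>H d\<close> is the restriction to the sphere of the quadratic form of the
  diagonal operator \<open>A\<close> with entries \<open>d\<close>; its Hamiltonian vector field is represented by \<open>-2\<i> A z\<close>.
  Diagonal operators commute with each other, hence so do the functions \<open>H d\<close>. The moduli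
  \<open>[z] \<mapsto> |z\<^sub>n|\<^sup>2\<close> are of this form, and their differentials are linearly independent wherever no
  coordinate vanishes, which is a dense set.

  The gradient of \<open>H c\<close> is represented by \<open>2 (A z - \<langle>A z, z\<rangle> z)\<close>, so that the probabilities
  \<open>p\<^sub>n = |z\<^sub>n|\<^sup>2\<close> obey the replicator equation \<open>p\<^sub>n' = 4 (c\<^sub>n - H c) p\<^sub>n\<close>. Ratios of solutions are
  exponentials, so \<open>p\<^sub>n(t)\<close> is \<open>p\<^sub>n(0) exp (4 c\<^sub>n t)\<close>, normalised. If the linear program is solvable, then
  \<open>c\<close> attains its maximum, and by dominated convergence \<open>p(t)\<close> tends to the normalised restriction of
  \<open>p(0)\<close> to the set of maximisers of \<open>c\<close>.
\<close>

section \<open>Coordinate functionals on the Hilbert space\<close>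

lemma coord_norm_le: "cmod (coord z n) \<le> norm z"
proof -
  have "(\<Sum>k\<in>{n}. (cmod (coord z k))\<^sup>2) \<le> (norm z)\<^sup>2"
    using sum_le_suminf[OF summable_coord[of z], of "{n}"] norm_sq_ell2[of z]
    by (simp add: sums_iff)
  then show ?thesis by (simp add: power2_le_iff_abs_le)
qed

lemma bounded_linear_coord: "bounded_linear (\<lambda>z. coord z n)"
  by (rule bounded_linear_intro[where K = 1]) (auto simp: coord_norm_le)

section \<open>Diagonal operators\<close>

text \<open>For unbounded \<open>d\<close> the product need not be square-summable, and
  \<open>Abs_ell2\<close> then has no specified value; hence the boundedness hypotheses on
  \<open>d\<close> below.\<close>

definition diag :: "(nat \<Rightarrow> real) \<Rightarrow> ell2 \<Rightarrow> ell2" where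
  "diag d z = Abs_ell2 (\<lambda>n. d n *\<^sub>R coord z n)"

lemma diag_bound_aux:
  assumes "\<And>n. \<bar>d n\<bar> \<le> B"
  shows "(cmod (d n *\<^sub>R coord z n))\<^sup>2 \<le> B\<^sup>2 * (cmod (coord z n))\<^sup>2"
proof -
  have "(d n)\<^sup>2 \<le> B\<^sup>2" using assms[of n] by (simp add: abs_le_square_iff[symmetric])
  then show ?thesis by (simp add: power_mult_distrib mult_right_mono)
qed

lemma coord_diag:
  assumes "bounded (range d)"
  shows "coord (diag d z) n = d n *\<^sub>R coord z n"
proof -
  obtain B where B: "\<And>n. \<bar>d n\<bar> \<le> B" using assms by (auto simp: bounded_iff)
  have "summable (\<lambda>n. (cmod (d n *\<^sub>R coord z n))\<^sup>2)"
    by (rule summable_comparison_test'[OF summable_mult[OF summable_coord[of z], of "B\<^sup>2"]])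
      (use diag_bound_aux[of d B, OF B] in simp)
  then show ?thesis unfolding diag_def by (simp add: Abs_ell2_inverse)
qed

lemma bounded_linear_diag:
  assumes "bounded (range d)"
  shows "bounded_linear (diag d)"
proof -
  obtain B where B: "\<And>n. \<bar>d n\<bar> \<le> B" using assms by (auto simp: bounded_iff)
  have B0: "0 \<le> B" using B[of 0] by linarith
  show ?thesis
  proof (rule bounded_linear_intro[where K = B])
    show "diag d (x + y) = diag d x + diag d y" for x y
      by (rule ell2_eqI) (simp add: coord_diag[OF assms] scaleR_add_right)
    show "diag d (r *\<^sub>R x) = r *\<^sub>R diag d x" for r x
      by (rule ell2_eqI) (simp add: coord_diag[OF assms])
    fix z
    have "(norm (diag d z))\<^sup>2 = (\<Sum>n. (cmod (coord (diag d z) n))\<^sup>2)"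
      using norm_sq_ell2 by (simp add: sums_iff)
    also have "\<dots> \<le> (\<Sum>n. B\<^sup>2 * (cmod (coord z n))\<^sup>2)"
      by (rule suminf_le[OF _ summable_coord summable_mult[OF summable_coord]])
        (unfold coord_diag[OF assms], rule diag_bound_aux, rule B)
    also have "\<dots> = (B * norm z)\<^sup>2"
      using norm_sq_ell2[of z] by (simp add: sums_iff suminf_mult power_mult_distrib)
    finally show "norm (diag d z) \<le> norm z * B"
      using B0 by (simp add: abs_le_square_iff[symmetric] mult.commute)
  qed
qed

lemma inner_diag:
  assumes "bounded (range d)"
  shows "inner (diag d v) w = (\<Sum>n. d n * inner (coord v n) (coord w n))"
  by (simp add: inner_ell2_def coord_diag[OF assms])

lemma inner_diag_commute:
  assumes "bounded (range d)"
  shows "inner (diag d v) w = inner v (diag d w)"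
  by (simp add: inner_ell2_def coord_diag[OF assms])

text \<open>Every summand is a real multiple of Re(z conj(iz)) = 0. This one orthogonality yields
  Poisson commutation and, with one sequence constant 1, the tangency and horizontality of the
  fields below.\<close>

lemma inner_diag_cscale_i:
  assumes "bounded (range d)" "bounded (range e)"
  shows "inner (diag d z) (cscale \<i> (diag e z)) = 0"
proof -
  have "d n * inner (coord z n) (coord (cscale \<i> (diag e z)) n) = 0" for n
    by (simp add: coord_diag[OF assms(2)] inner_complex_def)
  then show ?thesis unfolding inner_diag[OF assms(1)] by (simp only: suminf_zero)
qed

lemma diag_1: "diag (\<lambda>_. 1) z = z"
  by (rule ell2_eqI) (simp add: coord_diag)

lemma diag_cscale:
  assumes "bounded (range d)"
  shows "diag d (cscale a z) = cscale a (diag d z)"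
  by (rule ell2_eqI) (simp add: coord_diag[OF assms])

lemma H_proj_diag:
  assumes "bounded (range d)" "z \<in> unit_sphere"
  shows "H d (proj z) = inner (diag d z) z"
  by (simp add: H_proj[OF assms(2)] inner_diag[OF assms(1)] power2_norm_eq_inner)

section \<open>Smoothness of quadratic forms\<close>

text \<open>A quadratic form has only two nonzero derivatives: \<open>2 * inner (A x) h\<close>,
  where symmetry gives the factor 2, and \<open>2 * inner (A h) k\<close>, which is constant in
  \<open>x\<close>. So the Taylor remainder vanishes except at order zero, where it is
  \<open>inner (A h) h\<close>, at most K times the squared norm of \<open>h\<close>; the radius
  \<open>e / K\<close> suffices.\<close>

lemma smooth_on_quadratic_form:
  fixes A :: "'a::real_inner \<Rightarrow> 'a"
  assumes "bounded_linear A" and sym: "\<And>v w. inner (A v) w = inner v (A w)"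
  shows "smooth_on S (\<lambda>x. inner (A x) x)"
proof -
  interpret A: bounded_linear A by fact
  obtain K where K: "0 < K" "\<And>x. norm (A x) \<le> norm x * K" using A.pos_bounded by blast
  have KI: "\<bar>inner (A v) w\<bar> \<le> K * (norm v * norm w)" for v w
    using Cauchy_Schwarz_ineq2[of "A v" w] mult_right_mono[OF K(2)[of v], of "norm w"]
    by (simp add: mult_ac)
  define D where "D x vs = (case vs of [] \<Rightarrow> inner (A x) x | [h] \<Rightarrow> 2 * inner (A x) h
    | [h, k] \<Rightarrow> 2 * inner (A h) k | _ \<Rightarrow> 0)" for x :: 'a and vs :: "'a list"
  have D3: "D x vs = 0" if "length vs \<ge> 3" for x vs
    using that by (auto simp: D_def split: list.splits)
  show ?thesis
    unfolding smooth_on_def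
  proof (intro exI[of _ D] ballI conjI allI)
    fix x :: 'a and k :: nat
    show "D x [] = inner (A x) x" by (simp add: D_def)
    show "bounded_multilinear k (D x)"
      unfolding bounded_multilinear_def
    proof (intro conjI allI impI)
      fix us vs :: "'a list" assume k: "length us + length vs + 1 = k"
      consider "us = []" "vs = []" | w where "us = [w]" "vs = []" | w where "us = []" "vs = [w]"
        | "length us + length vs \<ge> 2"
        by (cases us; cases vs; cases "tl us"; cases "tl vs") auto
      then show "linear (\<lambda>h. D x (us @ h # vs))"
      proof cases
        case 4
        then show ?thesis by (auto intro!: linearI simp: D3)
      qed (auto intro!: linearI simp: D_def A.add A.scaleR algebra_simps)
    next
      consider "k = 0" | "k = 1" | "k = 2" | "k \<ge> 3" by linarith
      then show "\<exists>C. \<forall>vs. length vs = k \<longrightarrow> norm (D x vs) \<le> C * prod_list (map norm vs)"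
      proof cases
        case 1
        then show ?thesis by (auto intro!: exI[of _ "\<bar>inner (A x) x\<bar>"] simp: D_def)
      next
        case 2
        have "norm (D x [h]) \<le> (2 * K * norm x) * norm h" for h
          using KI[of x h] by (simp add: D_def abs_mult mult_ac)
        then show ?thesis
          using 2 by (intro exI[of _ "2 * K * norm x"]) (auto simp: length_Suc_conv)
      next
        case 3
        have "norm (D x [h, l]) \<le> (2 * K) * (norm h * norm l)" for h l
          using KI[of h l] by (simp add: D_def abs_mult mult_ac)
        then show ?thesis
          using 3 by (intro exI[of _ "2 * K"]) (auto simp: length_Suc_conv numeral_2_eq_2)
      next
        case 4
        then show ?thesis by (intro exI[of _ 0]) (simp add: D3)
      qed
    qed
  next
    fix x :: 'a and k :: nat and e :: real
    have "\<forall>e>0. \<exists>d>0. \<forall>h vs. norm h < d \<and> length vs = k \<longrightarrow>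
        norm (D (x + h) vs - D x vs - D x (h # vs)) \<le> e * norm h * prod_list (map norm vs)"
    proof (cases "k = 0")
      case True
      show ?thesis
      proof (intro allI impI)
        fix e :: real assume e: "e > 0"
        have "norm (D (x + h) [] - D x [] - D x [h]) \<le> e * norm h" if "norm h < e / K" for h
        proof -
          have "D (x + h) [] - D x [] - D x [h] = inner (A h) h"
            using sym[of h x] by (simp add: D_def A.add inner_add inner_commute)
          then have "norm (D (x + h) [] - D x [] - D x [h]) \<le> (K * norm h) * norm h"
            using KI[of h h] by (simp add: mult_ac)
          also have "\<dots> \<le> e * norm h"
            using that K(1) by (intro mult_right_mono) (simp_all add: field_simps)
          finally show ?thesis .
        qed
        then show "\<exists>d>0. \<forall>h vs. norm h < d \<and> length vs = k \<longrightarrow>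
            norm (D (x + h) vs - D x vs - D x (h # vs)) \<le> e * norm h * prod_list (map norm vs)"
          using True e K(1) by (intro exI[of _ "e / K"]) auto
      qed
    next
      case False
      have zero: "D (x + h) vs - D x vs - D x (h # vs) = 0" if "vs \<noteq> []" for h vs
        using that by (auto simp: D_def A.add inner_add_left split: list.splits)
      have "norm (D (x + h) vs - D x vs - D x (h # vs)) \<le> e * norm h * prod_list (map norm vs)"
        if "length vs = k" "e > 0" for e h vs
      proof -
        have "0 \<le> prod_list (map norm vs)" by (induction vs) auto
        moreover have "vs \<noteq> []" using that False by auto
        ultimately show ?thesis using zero that by simp
      qed
      then show ?thesis by (meson zero_less_one)
    qed
    then show "0 < e \<longrightarrow> (\<exists>d>0. \<forall>h vs. norm h < d \<and> length vs = k \<longrightarrow>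
        norm (D (x + h) vs - D x vs - D x (h # vs)) \<le> e * norm h * prod_list (map norm vs))"
      by blast
  qed
qed

lemma smooth_cp_H:
  assumes "bounded (range d)"
  shows "smooth_cp (H d)"
  unfolding smooth_cp_def
  using smooth_on_quadratic_form[OF bounded_linear_diag[OF assms] inner_diag_commute[OF assms]]
  by (auto simp: H_proj_diag[OF assms] intro!: exI[of _ UNIV] exI[of _ "\<lambda>z. inner (diag d z) z"])

section \<open>The differential and the Hamiltonian vector field of \<open>H\<close>\<close>

text \<open>Because \<open>v\<close> is orthogonal to the unit vector \<open>z\<close>, normalising
  only introduces the denominator 1 + s^2 |v|^2, which has no linear term. The derivative at 0 is
  therefore the linear coefficient of the numerator.\<close>

lemma H_derivative_along:
  assumes d: "bounded (range d)" and "tangent z v"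
  shows "((\<lambda>s. H d (proj (sgn (z + s *\<^sub>R v)))) has_real_derivative 2 * inner (diag d z) v) (at 0)"
proof -
  interpret A: bounded_linear "diag d" by (rule bounded_linear_diag[OF d])
  have zz: "inner z z = 1" "inner z v = 0"
    using assms(2) by (auto simp: tangent_def norm_eq_1)
  have n2: "inner (z + s *\<^sub>R v) (z + s *\<^sub>R v) = 1 + s\<^sup>2 * inner v v" for s
    using zz by (simp add: inner_add inner_commute[of v z] power2_eq_square)
  have pos: "1 + s\<^sup>2 * inner v v > 0" for s :: real
    by (simp add: add_pos_nonneg)
  have eq: "H d (proj (sgn (z + s *\<^sub>R v))) =
      (inner (diag d z) z + 2 * s * inner (diag d z) v + s\<^sup>2 * inner (diag d v) v)
      / (1 + s\<^sup>2 * inner v v)" for s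
  proof -
    let ?y = "z + s *\<^sub>R v"
    have y0: "?y \<noteq> 0" using n2[of s] pos[of s] by auto
    then have "sgn ?y \<in> unit_sphere" by (simp add: norm_sgn)
    then have "H d (proj (sgn ?y)) = inner (diag d ?y) ?y / (inner ?y ?y)"
      by (simp add: H_proj_diag[OF d] sgn_div_norm A.scaleR divide_simps
          flip: power2_norm_eq_inner power2_eq_square)
    also have "inner (diag d ?y) ?y =
        inner (diag d z) z + 2 * s * inner (diag d z) v + s\<^sup>2 * inner (diag d v) v"
      using inner_diag_commute[OF d, of v z]
      by (simp add: A.add A.scaleR inner_add inner_commute power2_eq_square algebra_simps)
    finally show ?thesis unfolding n2 .
  qed
  show ?thesis
    unfolding eq by (auto intro!: derivative_eq_intros)
qed

text \<open>The definite description is well defined because two representatives differ by a common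
  phase and a multiple of iz, and the real form \<open>inner (diag d z)\<close> vanishes on
  iz.\<close>

lemma differential_H:
  assumes d: "bounded (range d)" and "tangent z v"
  shows "differential (H d) (dproj z v) = 2 * inner (diag d z) v"
  unfolding differential_def
proof (rule the_equality)
  show "\<exists>z' v'. tangent z' v' \<and> dproj z v = dproj z' v' \<and>
     ((\<lambda>s. H d (proj (sgn (z' + s *\<^sub>R v')))) has_real_derivative 2 * inner (diag d z) v) (at 0)"
    using assms H_derivative_along by blast
  fix r
  assume "\<exists>z' v'. tangent z' v' \<and> dproj z v = dproj z' v' \<and>
     ((\<lambda>s. H d (proj (sgn (z' + s *\<^sub>R v')))) has_real_derivative r) (at 0)"
  then obtain z' v' where *: "tangent z' v'" "dproj z v = dproj z' v'"
    "((\<lambda>s. H d (proj (sgn (z' + s *\<^sub>R v')))) has_real_derivative r) (at 0)" by blast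
  have r: "r = 2 * inner (diag d z') v'"
    using DERIV_unique[OF *(3) H_derivative_along[OF d *(1)]] .
  obtain t a where "z' = cscale (cis t) z" "v' = cscale (cis t) (v + a *\<^sub>R cscale \<i> z)"
    using * assms dproj_eq_iff by metis
  then have "inner (diag d z') v' = inner (diag d z) v + a * inner (diag d z) (cscale \<i> z)"
    by (simp add: diag_cscale[OF d] inner_cscale_unit inner_add_right del: cscale_cscale)
  also have "inner (diag d z) (cscale \<i> z) = 0"
    using inner_diag_cscale_i[OF d, of "\<lambda>_. 1" z] by (simp add: diag_1)
  finally show "r = 2 * inner (diag d z) v" using r by simp
qed

definition unit_rep :: "cp \<Rightarrow> ell2" where
  "unit_rep p = (SOME z. z \<in> unit_sphere \<and> p = proj z)"

lemma unit_rep: "unit_rep p \<in> unit_sphere" "proj (unit_rep p) = p"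
proof -
  have "\<exists>z. z \<in> unit_sphere \<and> p = proj z" using proj_surj[of p] by metis
  from someI_ex[OF this] show "unit_rep p \<in> unit_sphere" "proj (unit_rep p) = p"
    unfolding unit_rep_def by auto
qed

text \<open>The factor -2i is forced by \<open>omega_eq\<close>: multiplication by i turns it into
  2, and \<open>2 * inner (diag d z) v\<close> is the differential.\<close>

definition ham :: "(nat \<Rightarrow> real) \<Rightarrow> cp \<Rightarrow> tcp" where
  "ham d p = dproj (unit_rep p) (cscale (-2 * \<i>) (diag d (unit_rep p)))"

lemma cscale_minus_2i: "cscale (-2 * \<i>) v = (-2) *\<^sub>R cscale \<i> v"
  by (rule ell2_eqI) (simp add: scaleR_conv_of_real)

lemma cscale_i_i: "cscale \<i> (cscale \<i> v) = - v"
  by (rule ell2_eqI) simp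

lemma tangent_ham:
  assumes d: "bounded (range d)" and z: "z \<in> unit_sphere"
  shows "tangent z (cscale (-2 * \<i>) (diag d z))"
  using z inner_diag_cscale_i[OF _ d, of "\<lambda>_. 1" z]
  unfolding cscale_minus_2i by (simp add: tangent_def diag_1)

lemma hamiltonian_vector_field_ham:
  assumes d: "bounded (range d)"
  shows "hamiltonian_vector_field (H d) (ham d)"
  unfolding hamiltonian_vector_field_def vector_field_def
proof (intro conjI allI)
  show "base (ham d p) = p" for p
    unfolding ham_def base_dproj[OF tangent_ham[OF d unit_rep(1)]] by (rule unit_rep)
  fix \<xi>
  \<comment> \<open>\<open>Omega_FS\<close> is evaluated on representatives over a common unit
    vector, so the test vector is lifted over the one that \<open>ham\<close> uses.\<close>
  define z where "z = unit_rep (base \<xi>)"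
  have z: "z \<in> unit_sphere" "base \<xi> = proj z" unfolding z_def by (simp_all only: unit_rep)
  obtain v where v: "tangent z v" "\<xi> = dproj z v" using dproj_surj_at[OF z] by blast
  have "Omega_FS (ham d (base \<xi>)) \<xi> = omega (cscale (-2 * \<i>) (diag d z)) v"
    unfolding ham_def z_def[symmetric]
    by (subst v(2)) (rule Omega_FS_dproj[OF tangent_ham[OF d z(1)] v(1)])
  also have "\<dots> = 2 * inner (diag d z) v"
    unfolding omega_eq cscale_minus_2i cscale_scaleR cscale_i_i by simp
  also have "\<dots> = differential (H d) \<xi>"
    using differential_H[OF d v(1)] v(2) by simp
  finally show "Omega_FS (ham d (base \<xi>)) \<xi> = differential (H d) \<xi>" .
qed

lemma poisson_commute_H:
  assumes d: "bounded (range d)" and e: "bounded (range e)"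
  shows "poisson_commute (H d) (H e)"
  unfolding poisson_commute_def
proof (rule exI[of _ "ham d"], rule exI[of _ "ham e"],
    intro conjI allI hamiltonian_vector_field_ham d e)
  fix p
  define z where "z = unit_rep p"
  have z: "z \<in> unit_sphere" unfolding z_def by (rule unit_rep)
  have "Omega_FS (ham d p) (ham e p) =
      omega (cscale (-2 * \<i>) (diag d z)) (cscale (-2 * \<i>) (diag e z))"
    unfolding ham_def z_def[symmetric]
    by (rule Omega_FS_dproj[OF tangent_ham[OF d z] tangent_ham[OF e z]])
  also have "\<dots> = 0"
    unfolding omega_eq cscale_minus_2i cscale_scaleR
    using inner_diag_cscale_i[OF d e, of z]
    by (simp add: cscale_i_i del: cscale_cscale)
  finally show "Omega_FS (ham d p) (ham e p) = 0" .
qed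

section \<open>Complete integrability\<close>

definition unit_vec :: "nat \<Rightarrow> nat \<Rightarrow> real" where
  "unit_vec n m = of_bool (m = n)"

lemma bounded_unit_vec: "bounded (range (unit_vec n))"
  by (auto simp: bounded_iff unit_vec_def intro!: exI[of _ 1])

lemma suminf_unit_vec: "(\<Sum>m. unit_vec n m * a m) = (a n :: real)"
proof -
  have "(\<Sum>m. unit_vec n m * a m) = (\<Sum>m\<in>{n}. unit_vec n m * a m)"
    by (rule suminf_finite) (auto simp: unit_vec_def)
  then show ?thesis by (simp add: unit_vec_def)
qed

lemma inner_diag_unit_vec: "inner (diag (unit_vec n) z) v = inner (coord z n) (coord v n)"
  by (simp add: inner_diag[OF bounded_unit_vec] suminf_unit_vec)

lemma coord_Abs_ell2_finite:
  assumes "finite {n. f n \<noteq> 0}"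
  shows "coord (Abs_ell2 f) n = f n"
proof -
  have "summable (\<lambda>n. (cmod (f n))\<^sup>2)"
    by (rule summable_finite[OF assms]) simp
  then show ?thesis by (simp add: Abs_ell2_inverse)
qed

text \<open>The basis vectors separate these functions. Injectivity makes the family infinite and
  lets sums over a set of functions be reindexed by their indices.\<close>

lemma inj_H_unit_vec: "inj (\<lambda>n. H (unit_vec n))"
proof (rule injI)
  fix n m assume eq: "H (unit_vec n) = H (unit_vec m)"
  define z where "z = Abs_ell2 (\<lambda>k. if k = n then 1 else 0)"
  have z: "coord z k = (if k = n then 1 else 0)" for k
    unfolding z_def by (rule coord_Abs_ell2_finite) simp
  have "inner z z = (\<Sum>k. unit_vec n k * 1)"
    unfolding inner_ell2_def by (rule suminf_cong) (simp add: z unit_vec_def)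
  then have "inner z z = 1" by (simp only: suminf_unit_vec)
  then have "z \<in> unit_sphere" by (simp add: norm_eq_1)
  then have "H (unit_vec k) (proj z) = inner (coord z k) (coord z k)" for k
    by (simp add: H_proj_diag bounded_unit_vec inner_diag_unit_vec)
  from this[of n] this[of m] eq have "inner (coord z n) (coord z n) = inner (coord z m) (coord z m)"
    by simp
  then show "n = m" by (simp add: z split: if_splits)
qed

lemma differentials_independent_H:
  assumes z: "z \<in> unit_sphere" "\<And>n. coord z n \<noteq> 0" and "finite N"
  shows "differentials_independent_at ((\<lambda>n. H (unit_vec n)) ` N) (proj z)"
  unfolding differentials_independent_at_def
proof (intro allI impI ballI, elim imageE)
  fix a f m
  assume a: "\<forall>\<xi>. base \<xi> = proj z \<longrightarrow>
      (\<Sum>f\<in>(\<lambda>n. H (unit_vec n)) ` N. a f * differential f \<xi>) = 0"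
    and m: "f = H (unit_vec m)" "m \<in> N"
  \<comment> \<open>The functions indexed by \<open>N\<close> do not see coordinate
    \<open>k\<close>, so the change of mass that tangency requires can be hidden there.\<close>
  obtain k where k: "k \<notin> N" using \<open>finite N\<close> ex_new_if_finite infinite_UNIV_nat by metis
  have km: "k \<noteq> m" using k m by auto
  let ?q = "\<lambda>n. inner (coord z n) (coord z n)"
  \<comment> \<open>A tangent vector that moves mass between the coordinates \<open>m\<close> and \<open>k\<close> isolates \<open>a f\<close>.\<close>
  define v where
    "v = Abs_ell2 (\<lambda>n. if n = m then ?q k *\<^sub>R coord z n
      else if n = k then - ?q m *\<^sub>R coord z n else 0)"
  have v: "coord v n =
      (if n = m then ?q k *\<^sub>R coord z n else if n = k then - ?q m *\<^sub>R coord z n else 0)" for n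
    unfolding v_def by (rule coord_Abs_ell2_finite, rule finite_subset[of _ "{m, k}"]) auto
  have "inner z v = (\<Sum>n\<in>{m, k}. inner (coord z n) (coord v n))"
    unfolding inner_ell2_def by (rule suminf_finite) (auto simp: v)
  then have t: "tangent z v" using z(1) km by (simp add: tangent_def v)
  have "0 = (\<Sum>f\<in>(\<lambda>n. H (unit_vec n)) ` N. a f * differential f (dproj z v))"
    using a t by (simp add: base_dproj)
  also have "\<dots> = (\<Sum>n\<in>N. a (H (unit_vec n)) * (2 * inner (coord z n) (coord v n)))"
    by (subst sum.reindex[OF inj_on_subset[OF inj_H_unit_vec subset_UNIV]])
      (simp add: differential_H[OF bounded_unit_vec t] inner_diag_unit_vec)
  also have "\<dots> = (\<Sum>n\<in>N. if n = m then a f * (2 * (?q k * ?q m)) else 0)"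
    by (rule sum.cong) (use k m in \<open>auto simp: v\<close>)
  also have "\<dots> = a f * (2 * (?q k * ?q m))" using \<open>finite N\<close> m by simp
  finally show "a f = 0" using z(2) by simp
qed

text \<open>A geometric sequence \<open>w\<close> placed exactly on the zero coordinates of
  \<open>z\<close> makes every coordinate of z + s w nonzero for s > 0; normalising and letting s
  tend to 0 approximates \<open>z\<close> within the sphere.\<close>

lemma dense_nonzero_coords:
  "unit_sphere \<subseteq> closure {z \<in> unit_sphere. \<forall>n. coord z n \<noteq> 0}"
proof
  fix z assume z: "z \<in> unit_sphere"
  define w where "w = Abs_ell2 (\<lambda>n. if coord z n = 0 then (1 / 2) ^ n else 0)"
  have "summable (\<lambda>n. (cmod (if coord z n = 0 then (1 / 2) ^ n else 0))\<^sup>2)"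
  proof (rule summable_comparison_test')
    show "summable (\<lambda>n. (1 / 4 :: real) ^ n)" by (rule summable_geometric) simp
    show "norm ((cmod (if coord z n = 0 then (1 / 2) ^ n else 0))\<^sup>2) \<le> (1 / 4 :: real) ^ n" for n
      by (simp add: norm_power norm_divide power2_eq_square flip: power_mult_distrib)
  qed
  then have w: "coord w n = (if coord z n = 0 then (1 / 2) ^ n else 0)" for n
    unfolding w_def by (simp add: Abs_ell2_inverse)
  have nz: "coord (z + s *\<^sub>R w) n \<noteq> 0" if "s > 0" for s n
    using that by (simp add: w)
  have "((\<lambda>s. sgn (z + s *\<^sub>R w)) \<longlongrightarrow> sgn (z + 0 *\<^sub>R w)) (at_right 0)"
    using z by (intro tendsto_intros) auto
  then have lim: "((\<lambda>s. sgn (z + s *\<^sub>R w)) \<longlongrightarrow> z) (at_right 0)"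
    using z by (simp add: sgn_div_norm)
  have "\<forall>\<^sub>F s in at_right 0. sgn (z + s *\<^sub>R w) \<in> {z \<in> unit_sphere. \<forall>n. coord z n \<noteq> 0}"
    unfolding eventually_at_right_field
  proof (intro exI[of _ 1] conjI allI impI)
    fix s :: real assume "0 < s"
    then have "z + s *\<^sub>R w \<noteq> 0" using nz[of s 0] by (metis coord_zero)
    then show "sgn (z + s *\<^sub>R w) \<in> {z \<in> unit_sphere. \<forall>n. coord z n \<noteq> 0}"
      using nz[OF \<open>0 < s\<close>] by (simp add: norm_sgn sgn_div_norm)
  qed simp
  then show "z \<in> closure {z \<in> unit_sphere. \<forall>n. coord z n \<noteq> 0}"
    by (intro Lim_in_closed_set[OF closed_closure _ _ lim])
      (auto elim!: eventually_mono intro: closure_subset[THEN subsetD])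
qed

lemma completely_integrable_H:
  assumes c: "bounded (range c)"
  shows "completely_integrable (H c)"
  unfolding completely_integrable_def
proof (intro exI[of _ "range (\<lambda>n. H (unit_vec n))"] conjI ballI)
  show "infinite (range (\<lambda>n. H (unit_vec n)))"
    using finite_imageD[OF _ inj_H_unit_vec] by auto
  show "conserved_quantity (H c) f" if "f \<in> range (\<lambda>n. H (unit_vec n))" for f
    using that c
    by (auto simp: conserved_quantity_def smooth_cp_H bounded_unit_vec poisson_commute_H)
  show "poisson_commute f g"
    if "f \<in> range (\<lambda>n. H (unit_vec n))" "g \<in> range (\<lambda>n. H (unit_vec n))" for f g
    using that by (auto simp: bounded_unit_vec poisson_commute_H)
  show "functionally_independent (range (\<lambda>n. H (unit_vec n)))"
    unfolding functionally_independent_def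
  proof (intro allI impI)
    fix F0 :: "(cp \<Rightarrow> real) set"
    assume "F0 \<subseteq> range (\<lambda>n. H (unit_vec n)) \<and> finite F0"
    then obtain N where N: "finite N" "F0 = (\<lambda>n. H (unit_vec n)) ` N"
      by (meson finite_subset_image)
    show "unit_sphere \<subseteq> closure {z \<in> unit_sphere. differentials_independent_at F0 (proj z)}"
      by (rule subset_trans[OF dense_nonzero_coords closure_mono])
        (auto simp: N intro!: differentials_independent_H)
  qed
qed

section \<open>The gradient flow\<close>

lemma horizontal_gradient:
  assumes d: "bounded (range d)" and z: "z \<in> unit_sphere"
  shows "horizontal z (2 *\<^sub>R (diag d z - inner (diag d z) z *\<^sub>R z))"
  using z inner_diag_cscale_i[OF d, of "\<lambda>_. 1" z] inner_cscale_i[of z]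
  by (simp add: horizontal_def tangent_def diag_1 inner_diff norm_eq_1 inner_commute)

text \<open>Uniqueness of the gradient. \<open>metric_FS\<close> is computed on horizontal
  representatives, so an arbitrary representative of X is first made horizontal. Its difference from
  the candidate is then horizontal and orthogonal to all horizontal vectors, itself
  included.\<close>

lemma gradient_field_H:
  assumes d: "bounded (range d)" and "gradient_field (H d) X" and z: "z \<in> unit_sphere"
  shows "X (proj z) = dproj z (2 *\<^sub>R (diag d z - inner (diag d z) z *\<^sub>R z))"
proof -
  define g where "g = 2 *\<^sub>R (diag d z - inner (diag d z) z *\<^sub>R z)"
  have g: "horizontal z g" unfolding g_def by (rule horizontal_gradient[OF d z])
  have X: "base (X (proj z)) = proj z"
    "base \<xi> = proj z \<Longrightarrow> metric_FS (X (proj z)) \<xi> = differential (H d) \<xi>" for \<xi>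
    using assms(2) by (auto simp: gradient_field_def vector_field_def) metis
  obtain v where v: "tangent z v" "X (proj z) = dproj z v" using dproj_surj_at[OF z X(1)] by blast
  \<comment> \<open>As iz is a unit vector, this coefficient removes the vertical component of
    \<open>v\<close>.\<close>
  define a where "a = - inner (cscale \<i> z) v"
  define w where "w = v + a *\<^sub>R cscale \<i> z"
  have z1: "inner z z = 1" using z by (simp add: norm_eq_1)
  have w: "horizontal z w"
    using v(1) z1 inner_cscale_i[of z]
    by (simp add: horizontal_def tangent_def w_def a_def inner_add inner_diff inner_cscale_unit
        inner_commute)
  then have tw: "tangent z w" by (simp add: horizontal_def)
  have "\<exists>t b. z = cscale (cis t) z \<and> w = cscale (cis t) (v + b *\<^sub>R cscale \<i> z)"
    by (rule exI[of _ 0], rule exI[of _ a]) (simp add: w_def)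
  then have Xw: "X (proj z) = dproj z w" using dproj_eq_iff[OF v(1) tw] v(2) by simp
  have "inner w u = inner g u" if u: "horizontal z u" for u
  proof -
    have tu: "tangent z u" using u by (simp add: horizontal_def)
    have "inner w u = metric_FS (X (proj z)) (dproj z u)"
      by (simp add: Xw metric_FS_dproj[OF w u])
    also have "\<dots> = differential (H d) (dproj z u)" using tu by (intro X(2)) (simp add: base_dproj)
    also have "\<dots> = inner g u"
      using tu by (simp add: differential_H[OF d tu] g_def inner_diff tangent_def)
    finally show ?thesis .
  qed
  then have "inner (w - g) (w - g) = 0"
    using w g by (auto simp: horizontal_def tangent_def inner_diff)
  then show ?thesis unfolding Xw by (simp add: g_def)
qed

text \<open>The velocity is witnessed by some local lift \<open>z\<close>, whereas \<open>x\<close>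
  itself need not be differentiable. The squared moduli are invariant under phases, so they can be
  differentiated along \<open>z\<close> and carried over to \<open>x\<close>.\<close>

lemma gradient_flow_H_derivative:
  assumes c: "bounded (range c)" and "gradient_flow_line (H c) T (\<lambda>t. proj (x t))"
    and x: "\<And>t. t \<in> T \<Longrightarrow> x t \<in> unit_sphere" and t: "t \<in> T"
  shows "((\<lambda>s. (cmod (coord (x s) n))\<^sup>2) has_real_derivative
    4 * (c n - H c (proj (x t))) * (cmod (coord (x t) n))\<^sup>2) (at t within T)"
proof -
  obtain X where X: "gradient_field (H c) X" "has_velocity (\<lambda>t. proj (x t)) (X (proj (x t))) t T"
    using assms(2) t unfolding gradient_flow_line_def by blast
  obtain z v where z: "\<forall>\<^sub>F s in at t within T. z s \<in> unit_sphere \<and> proj (z s) = proj (x s)"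
    "z t \<in> unit_sphere" "proj (z t) = proj (x t)"
    "(z has_vector_derivative v) (at t within T)" "tangent (z t) v" "X (proj (x t)) = dproj (z t) v"
    using X(2) unfolding has_velocity_def by blast
  define h where "h = inner (diag c (z t)) (z t)"
  define g where "g = 2 *\<^sub>R (diag c (z t) - h *\<^sub>R z t)"
  have h: "h = H c (proj (x t))"
    unfolding h_def z(3)[symmetric] by (rule H_proj_diag[OF c z(2), symmetric])
  have "tangent (z t) g"
    using horizontal_gradient[OF c z(2)] unfolding g_def h_def horizontal_def by blast
  moreover have "dproj (z t) g = dproj (z t) v"
    using gradient_field_H[OF c X(1) z(2)] z(3,6) by (simp add: g_def h_def)
  ultimately obtain b a where ba: "z t = cscale (cis b) (z t)"
    "v = cscale (cis b) (g + a *\<^sub>R cscale \<i> (z t))"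
    using dproj_eq_iff z(5) by metis
  \<comment> \<open>The phase fixes \<open>z t\<close>, so it can be put in front of both arguments
    and cancelled; the vertical term then contributes nothing to the radial derivative.\<close>
  have "inner (coord (z t) n) (coord v n)
      = inner (cis b * coord (z t) n) (cis b * coord (g + a *\<^sub>R cscale \<i> (z t)) n)"
    using ba by (metis coord_cscale)
  also have "\<dots> = inner (coord (z t) n) (coord (g + a *\<^sub>R cscale \<i> (z t)) n)"
    by (rule inner_unit_mult) simp
  also have "\<dots> = 2 * (c n - h) * (cmod (coord (z t) n))\<^sup>2
      + a * inner (coord (z t) n) (\<i> * coord (z t) n)"
    by (simp add: g_def coord_diag[OF c] inner_diff inner_add power2_norm_eq_inner algebra_simps)
  also have "inner (coord (z t) n) (\<i> * coord (z t) n) = 0" by (simp add: inner_complex_def)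
  finally have v: "2 * inner (coord (z t) n) (coord v n) = 4 * (c n - h) * (cmod (coord (z t) n))\<^sup>2"
    by simp
  have phase: "(cmod (coord w n))\<^sup>2 = (cmod (coord y n))\<^sup>2"
    if "w \<in> unit_sphere" "y \<in> unit_sphere" "proj w = proj y" for w y
    using that proj_eq_iff[of w y] by (auto simp: norm_mult)
  have "((\<lambda>s. coord (z s) n) has_vector_derivative coord v n) (at t within T)"
    by (rule bounded_linear.has_vector_derivative[OF bounded_linear_coord z(4)])
  then have "((\<lambda>s. coord (z s) n) has_derivative (\<lambda>r. r *\<^sub>R coord v n)) (at t within T)"
    by (simp add: has_vector_derivative_def)
  from has_derivative_inner[OF this this]
  have "((\<lambda>s. (cmod (coord (z s) n))\<^sup>2) has_real_derivative 2 * inner (coord (z t) n) (coord v n))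
      (at t within T)"
    unfolding has_field_derivative_def power2_norm_eq_inner
    by (rule has_derivative_eq_rhs) (simp add: fun_eq_iff inner_commute)
  then have "((\<lambda>s. (cmod (coord (z s) n))\<^sup>2) has_real_derivative
      4 * (c n - h) * (cmod (coord (x t) n))\<^sup>2) (at t within T)"
    unfolding v using phase[OF z(2) x[OF t] z(3)] by simp
  moreover have ev: "\<forall>\<^sub>F s in at t within T. (cmod (coord (z s) n))\<^sup>2 = (cmod (coord (x s) n))\<^sup>2"
    using z(1) unfolding eventually_at_filter by eventually_elim (use phase x in blast)
  ultimately show ?thesis
    unfolding h
    using has_field_derivative_cong_eventually[OF ev phase[OF z(2) x[OF t] z(3)]] by simp
qed

text \<open>The common term \<open>h\<close> cancels in the logarithmic derivative of a quotient of
  two components, so the quotient is an explicit exponential. The product form can be summed over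
  \<open>n\<close> directly.\<close>

lemma replicator_ratio:
  fixes p :: "real \<Rightarrow> nat \<Rightarrow> real"
  assumes pos: "\<And>t n. t \<ge> 0 \<Longrightarrow> p t n > 0"
    and deriv: "\<And>t n. t \<ge> 0 \<Longrightarrow>
      ((\<lambda>s. p s n) has_real_derivative 4 * (c n - h t) * p t n) (at t within {0..})"
    and t: "t \<ge> 0"
  shows "p t n * p 0 k = p t k * (p 0 n * exp (4 * (c n - c k) * t))"
proof -
  define r where "r s = p s n / p s k * exp (- 4 * (c n - c k) * s)" for s
  have "(r has_real_derivative 0) (at s within {0..})" if "s \<in> {0..}" for s
  proof -
    have s: "s \<ge> 0" using that by simp
    have "((\<lambda>s. exp (- 4 * (c n - c k) * s)) has_real_derivative
        - 4 * (c n - c k) * exp (- 4 * (c n - c k) * s)) (at s within {0..})"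
      by (auto intro!: derivative_eq_intros)
    note dexp = this
    have pk: "p s k \<noteq> 0" using pos[OF s, of k] by simp
    show ?thesis
      unfolding r_def[abs_def]
      by (rule DERIV_cong[OF DERIV_mult[OF DERIV_divide[OF deriv[OF s] deriv[OF s] pk] dexp]])
        (use pk in \<open>simp add: field_simps\<close>)
  qed
  then obtain C where "\<And>s. s \<ge> 0 \<Longrightarrow> r s = C"
    using has_field_derivative_zero_constant[of "{0..}" r] by auto
  then have "r t = r 0" using t by simp
  moreover define E where "E = exp (4 * (c n - c k) * t)"
  moreover have "exp (- 4 * (c n - c k) * t) = inverse E"
    by (simp add: E_def algebra_simps flip: exp_minus)
  ultimately have "p t n / p t k * inverse E = p 0 n / p 0 k" by (simp add: r_def)
  moreover have "E > 0" by (simp add: E_def)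
  ultimately show ?thesis
    using pos[OF t, of k] pos[of 0 k] unfolding E_def[symmetric] by (simp add: field_simps)
qed

section \<open>The limit\<close>

lemma summable_pairing:
  assumes "bounded (range c)" "p \<in> Delta_bar"
  shows "summable (\<lambda>n. c n * p n)"
proof -
  obtain B where B: "\<And>n. \<bar>c n\<bar> \<le> B" using assms(1) by (auto simp: bounded_iff)
  have p: "summable p" "\<And>n. p n \<ge> 0" using assms(2) by (auto simp: Delta_bar_def sums_iff)
  show ?thesis
    by (rule summable_comparison_test'[OF summable_mult[OF p(1), of B]])
      (use B p(2) in \<open>auto simp: abs_mult intro!: mult_right_mono\<close>)
qed

text \<open>Testing against the vertices \<open>unit_vec n\<close> bounds every \<open>c n\<close>
  by the optimal value. That value is the \<open>q\<close>-average of \<open>c\<close>, so the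
  nonnegative terms \<open>?f n\<close> sum to 0 and \<open>c\<close> equals the optimum wherever
  \<open>q\<close> has mass.\<close>

lemma solves_lp_attains_max:
  assumes c: "bounded (range c)" and "solves_lp c q"
  obtains k where "\<And>n. c n \<le> c k"
proof -
  have q: "q sums 1" "\<And>n. q n \<ge> 0" "\<And>p. p \<in> Delta_bar \<Longrightarrow> pairing c p \<le> pairing c q"
    using assms(2) by (auto simp: solves_lp_def Delta_bar_def)
  have sq: "summable q" "suminf q = 1" using q(1) by (simp_all add: sums_iff)
  have cq: "summable (\<lambda>n. c n * q n)"
    using c assms(2) by (simp add: summable_pairing solves_lp_def)
  have le: "c n \<le> pairing c q" for n
  proof -
    have "unit_vec n sums 1"
      using sums_single[of n "\<lambda>_. 1 :: real"] by (simp add: unit_vec_def[abs_def] of_bool_def)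
    then have "unit_vec n \<in> Delta_bar" by (auto simp: Delta_bar_def unit_vec_def)
    from q(3)[OF this] show ?thesis
      using suminf_unit_vec[of n c] by (simp add: pairing_def mult.commute)
  qed
  let ?f = "\<lambda>n. (pairing c q - c n) * q n"
  have sf: "summable ?f" "suminf ?f = 0"
    using summable_diff[OF summable_mult[OF sq(1)] cq, of "pairing c q"]
      suminf_diff[OF summable_mult[OF sq(1)] cq, of "pairing c q"]
      suminf_mult[OF sq(1), of "pairing c q"] sq(2) pairing_def[of c q]
    by (simp_all add: left_diff_distrib)
  then have "\<forall>n. ?f n = 0"
    using suminf_eq_zero_iff[OF sf(1)] le q(2) by simp
  moreover have "\<exists>k. q k \<noteq> 0"
    using sq(2) by (metis suminf_zero zero_neq_one ext)
  ultimately obtain k where "c k = pairing c q" by force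
  then show ?thesis using le that by metis
qed

text \<open>Tannery's theorem, with the domination asked only at nonnegative times, where the flow
  line lives.\<close>

lemma tendsto_suminf_dominated:
  fixes a :: "real \<Rightarrow> nat \<Rightarrow> real"
  assumes "\<And>n. ((\<lambda>t. a t n) \<longlongrightarrow> b n) at_top" "\<And>t n. t \<ge> 0 \<Longrightarrow> \<bar>a t n\<bar> \<le> M n" "summable M"
  shows "((\<lambda>t. \<Sum>n. a t n) \<longlongrightarrow> suminf b) at_top"
proof -
  have "eventually (\<lambda>(n, t). norm (a t n) \<le> M n) (at_top \<times>\<^sub>F at_top)"
    unfolding eventually_prod_filter
    using assms(2) eventually_ge_at_top[of "0::real"]
    by (intro exI[of _ "\<lambda>_. True"] exI[of _ "\<lambda>t. t \<ge> 0"]) auto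
  from tannerys_theorem[OF assms(1) this assms(3)] show ?thesis by simp
qed

text \<open>Subtracting the maximum \<open>c k\<close> in the exponent keeps the weights
  \<open>a t n\<close> below the summable \<open>p 0 n\<close>, while their sum \<open>Z t\<close>
  stays above \<open>S\<close>, the initial mass of the maximisers of \<open>c\<close>. Dominated
  convergence then applies to the normalised weights.\<close>

lemma replicator_limit:
  fixes p :: "real \<Rightarrow> nat \<Rightarrow> real"
  assumes p: "\<And>t. t \<ge> 0 \<Longrightarrow> p t \<in> Delta" and c: "bounded (range c)"
    and k: "\<And>n. c n \<le> c k"
    and ratio: "\<And>t n. t \<ge> 0 \<Longrightarrow> p t n * p 0 k = p t k * (p 0 n * exp (4 * (c n - c k) * t))"
  obtains q where "l1_tendsto p q at_top" "solves_lp c q"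
proof -
  have pos: "p t n > 0" and p1: "summable (p t)" "suminf (p t) = 1" if "t \<ge> 0" for t n
    using p[OF that] by (auto simp: Delta_def sums_iff)
  define a where "a t n = p 0 n * exp (4 * (c n - c k) * t)" for t n
  define Z where "Z t = (\<Sum>n. a t n)" for t
  define b where "b n = (if c n = c k then p 0 n else 0)" for n
  define S where "S = suminf b"
  have a: "0 < a t n" "a t n \<le> p 0 n" "b n \<le> a t n" if "t \<ge> 0" for t n
  proof -
    have "4 * (c n - c k) * t \<le> 0" using k[of n] that by (simp add: mult_nonpos_nonneg)
    then show "a t n \<le> p 0 n" using pos[of 0 n] by (simp add: a_def mult_le_cancel_left1)
    show "0 < a t n" using pos[of 0 n] by (simp add: a_def)
    then show "b n \<le> a t n" by (simp add: b_def a_def)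
  qed
  have b0: "0 \<le> b n" "b n \<le> p 0 n" for n using pos[of 0 n] by (simp_all add: b_def)
  have sa: "summable (a t)" if "t \<ge> 0" for t
    by (rule summable_comparison_test'[OF p1(1)[of 0]]) (use a[OF that] in \<open>auto simp: less_imp_le\<close>)
  have sb: "summable b"
    by (rule summable_comparison_test'[OF p1(1)[of 0]]) (use b0 in auto)
  have S: "0 < S" unfolding S_def
    by (rule suminf_pos2[OF sb, of k]) (use b0 pos[of 0 k] in \<open>auto simp: b_def\<close>)
  have SZ: "S \<le> Z t" if "t \<ge> 0" for t
    unfolding S_def Z_def by (rule suminf_le[OF a(3)[OF that] sb sa[OF that]])
  have lim_a: "((\<lambda>t. a t n) \<longlongrightarrow> b n) at_top" for n
  proof (cases "c n = c k")
    case False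
    then have "4 * (c n - c k) < 0" using k[of n] by simp
    then have "((\<lambda>t. p 0 n * exp (4 * (c n - c k) * t)) \<longlongrightarrow> p 0 n * 0) at_top"
      by (intro tendsto_intros filterlim_compose[OF exp_at_bot]
          filterlim_tendsto_neg_mult_at_bot[OF tendsto_const] filterlim_ident)
    then show ?thesis using False by (simp add: a_def b_def)
  qed (simp add: a_def b_def)
  have lim_Z: "(Z \<longlongrightarrow> S) at_top"
    unfolding Z_def[abs_def] S_def using a
    by (intro tendsto_suminf_dominated[OF lim_a _ p1(1)[of 0]]) (auto simp: less_imp_le)
  have pa: "p t n = a t n / Z t" if "t \<ge> 0" for t n
  proof -
    \<comment> \<open>Summing the ratio identity over \<open>n\<close> determines
      \<open>p t k\<close>, since the components of \<open>p t\<close> sum to 1.\<close>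
    have "p 0 k = (\<Sum>n. p t n * p 0 k)"
      using suminf_mult2[OF p1(1)[OF that], of "p 0 k"] p1(2)[OF that] by simp
    also have "\<dots> = p t k * Z t"
      unfolding Z_def suminf_mult[OF sa[OF that], symmetric] ratio[OF that] a_def ..
    finally have "p 0 k = p t k * Z t" .
    then show ?thesis
      using ratio[OF that, of n] pos[OF that, of k] SZ[OF that] S pos[of 0 k]
      by (simp add: a_def field_simps)
  qed
  define q where "q n = b n / S" for n
  have q1: "q sums 1"
    using sums_divide[OF summable_sums[OF sb], of S] S by (simp add: q_def[abs_def] S_def)
  have q0: "q n \<ge> 0" for n using b0 S by (simp add: q_def)
  have "((\<lambda>t. \<Sum>n. \<bar>p t n - q n\<bar>) \<longlongrightarrow> (\<Sum>n. 0)) at_top"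
  proof (rule tendsto_suminf_dominated)
    fix n
    have "((\<lambda>t. \<bar>a t n / Z t - q n\<bar>) \<longlongrightarrow> \<bar>b n / S - q n\<bar>) at_top"
      using S by (intro tendsto_intros lim_a lim_Z) simp
    moreover have "\<forall>\<^sub>F t in at_top. \<bar>a t n / Z t - q n\<bar> = \<bar>p t n - q n\<bar>"
      using eventually_ge_at_top[of "0::real"] by eventually_elim (simp add: pa)
    ultimately show "((\<lambda>t. \<bar>p t n - q n\<bar>) \<longlongrightarrow> 0) at_top"
      by (simp add: q_def tendsto_cong)
  next
    fix t :: real and n assume t: "t \<ge> 0"
    \<comment> \<open>Both sequences lie between 0 and \<open>p 0 n / S\<close>, so this summable
      bound also dominates their distance.\<close>
    have "0 \<le> p t n" "p t n \<le> p 0 n / S"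
      using pos[OF t, of n] pa[OF t, of n] frac_le[OF _ a(2)[OF t] S SZ[OF t], of n] pos[of 0 n]
      by auto
    moreover have "0 \<le> q n" "q n \<le> p 0 n / S"
      using q0 b0(2)[of n] S by (auto simp: q_def divide_right_mono)
    ultimately show "\<bar>\<bar>p t n - q n\<bar>\<bar> \<le> p 0 n / S" by linarith
  qed (use p1(1)[of 0] in \<open>simp add: summable_divide\<close>)
  then have 1: "l1_tendsto p q at_top" by (simp add: l1_tendsto_def)
  have pairing_le: "pairing c r \<le> c k" if "r \<in> Delta_bar" for r
  proof -
    have r: "summable r" "suminf r = 1" "\<And>n. r n \<ge> 0"
      using that by (auto simp: Delta_bar_def sums_iff)
    have "summable (\<lambda>n. c n * r n)" by (rule summable_pairing[OF c that])
    then have "pairing c r \<le> (\<Sum>n. c k * r n)"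
      unfolding pairing_def by (intro suminf_le summable_mult r(1) mult_right_mono k r(3))
    then show ?thesis using r by (simp add: suminf_mult)
  qed
  \<comment> \<open>The limit \<open>q\<close> is supported on the maximisers of \<open>c\<close>,
    so its value is the upper bound \<open>c k\<close>.\<close>
  have "c n * q n = c k * q n" for n by (simp add: q_def b_def)
  then have "pairing c q = (\<Sum>n. c k * q n)" unfolding pairing_def by (intro suminf_cong)
  then have "pairing c q = c k" using q1 by (simp add: suminf_mult sums_iff)
  then have "solves_lp c q"
    using pairing_le q0 q1 by (simp add: solves_lp_def Delta_bar_def)
  with 1 show ?thesis by (rule that)
qed

text \<open>Solvability of the program is a premise of the limit claim because the maximum need not
  be attained, for instance when all entries of \<open>c\<close> are negative.\<close>

theorem theorem3:
  fixes c :: "nat \<Rightarrow> real"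
  assumes "summable (\<lambda>n. (c n)\<^sup>2)"
  shows "completely_integrable (H c) \<and>
    (\<forall>x :: real \<Rightarrow> ell2.
       (\<forall>t\<ge>0. x t \<in> U) \<and> gradient_flow_line (H c) {0..} (\<lambda>t. proj (x t)) \<and>
       (\<exists>p. solves_lp c p) \<longrightarrow>
       (\<exists>p_max. l1_tendsto (\<lambda>t. inv_into Delta Phi (x t)) p_max at_top \<and> solves_lp c p_max))"
proof (intro conjI allI impI)
  \<comment> \<open>Square-summability enters as boundedness: the squares tend to 0, hence so does
    \<open>c\<close>.\<close>
  have "(\<lambda>n. (c n)\<^sup>2) \<longlonglongrightarrow> 0" using assms by (rule summable_LIMSEQ_zero)
  then have "c \<longlonglongrightarrow> 0" using tendsto_real_sqrt[of "\<lambda>n. (c n)\<^sup>2" 0]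
    by (simp add: tendsto_rabs_zero_iff)
  then have c: "bounded (range c)" by (intro convergent_imp_bounded convergentI)
  then show "completely_integrable (H c)" by (rule completely_integrable_H)
  fix x :: "real \<Rightarrow> ell2"
  assume x: "(\<forall>t\<ge>0. x t \<in> U) \<and> gradient_flow_line (H c) {0..} (\<lambda>t. proj (x t)) \<and>
       (\<exists>p. solves_lp c p)"
  then obtain k where k: "\<And>n. c n \<le> c k" using solves_lp_attains_max[OF c] by metis
  define p where "p t = inv_into Delta Phi (x t)" for t
  have U: "x t \<in> U" "x t \<in> unit_sphere" if "t \<ge> 0" for t using x that by (auto simp: U_def)
  have p: "p t n = (cmod (coord (x t) n))\<^sup>2" if "t \<ge> 0" for t n
    using U[OF that] by (simp add: p_def inv_into_Phi U_def cmod_power2)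
  have D: "p t \<in> Delta" if "t \<ge> 0" for t
    using sq_mem_Delta(1)[OF U(1)[OF that]] inv_into_Phi[OF U(1)[OF that]] by (simp add: p_def)
  have "((\<lambda>s. p s n) has_real_derivative 4 * (c n - H c (proj (x t))) * p t n) (at t within {0..})"
    if t: "t \<ge> 0" for t n
  \<comment> \<open>\<open>p\<close> is identified with the squared moduli only at nonnegative
    times, so the derivative is transferred within \<open>{0..}\<close>; the radius 1 is
    arbitrary.\<close>
  proof (rule has_field_derivative_transform_within[where d = 1])
    show "((\<lambda>s. (cmod (coord (x s) n))\<^sup>2) has_real_derivative
        4 * (c n - H c (proj (x t))) * p t n) (at t within {0..})"
      unfolding p[OF t] by (rule gradient_flow_H_derivative[OF c]) (use x U t in auto)
  qed (use t p in auto)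
  then have ratio: "p t n * p 0 k = p t k * (p 0 n * exp (4 * (c n - c k) * t))" if "t \<ge> 0" for t n
    using replicator_ratio[of p c "\<lambda>t. H c (proj (x t))" t n k] D that by (auto simp: Delta_def)
  show "\<exists>p_max. l1_tendsto (\<lambda>t. inv_into Delta Phi (x t)) p_max at_top \<and> solves_lp c p_max"
    using replicator_limit[OF D c k ratio] unfolding p_def[abs_def] by metis
qed

end
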